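(* Let $F_\theta$ be a member of the exponential-type parametric family with unbounded support ($x_F=\infty$), satisfying the unbounded endpoint regularity condition with constants $c_+,c_+'\in[0,\theta)$. For each $n$, let $\tau^*$ be the optimal full-information stopping rule for $X_1,\dots,X_n$ i.i.d. from $F_\theta$. Then, as $n\to\infty$, $$\mathbb E_\theta[X_{\tau^*}]=\left(\frac{\theta}{\theta-c_+}\right)^{c_+/\theta}\psi\!\left(\frac{\log n}{\theta}\right)(1+o(1)),$$ $$\mathrm{OPT}(\theta)=\Gamma\!\left(1-\frac{c_+}{\theta}\right)\psi\!\left(\frac{\log n}{\theta}\right)(1+o(1)),$$ and therefore $$\lim_{n\to\infty}\mathrm{CR}_n(\tau^*;\theta)=\frac{\left(\frac{\theta}{\theta-c_+}\right)^{c_+/\theta}}{\Gamma\!\left(1-\frac{c_+}{\theta}\right)}.$$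
   Context: Exponential-type parametric family: $\theta>0$, $0\le x_0<x_F\le\infty$, and $\phi:[x_0,x_F)\to[0,\infty)$ is a strictly increasing function with $\phi(x_0)=0$ and $\phi(x)\to\infty$ as $x\uparrow x_F$, with inverse $\psi:=\phi^{-1}:[0,\infty)\to[x_0,x_F)$ (so $\phi$ is a bijection). The CDF is $F_\theta(x)=0$ for $x<x_0$, $F_\theta(x)=1-\exp(-\theta\phi(x))$ for $x_0\le x<x_F$, and $F_\theta(x)=1$ for $x\ge x_F$. Unbounded endpoint regularity condition: $x_F=\infty$, $\psi$ is eventually (i.e. for all large arguments) twice differentiable, and there exist constants $c_+,c_+'\in[0,\theta)$ with $\lim_{y\to\infty}\psi'(y)/\psi(y)=c_+$ and $\lim_{y\to\infty}\psi''(y)/\psi'(y)=c_+'$. Stopping problem: $X_1,\dots,X_n$ are i.i.d. from $F_\theta$; $X_{n+1}:=0$. A policy is a stopping time $\tau\in\{1,\dots,n\}\cup\{n+1\}$ adapted to the sequentially observed $(X_t)$, with reward $X_\tau$. $\mathrm{OPT}(\theta):=\mathbb E_\theta[\max_{t\in[n]}X_t]$ and $\mathrm{CR}_n(\tau;\theta):=\mathbb E_\theta[X_\tau]/\mathrm{OPT}(\theta)$. The optimal full-information stopping rule $\tau^*$ is the stopping time maximizing $\mathbb E_\theta[X_\tau]$ when $\theta$ (hence $F_\theta$) is known. $\Gamma$ is the Gamma function. *)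

theory Defs
  imports "HOL-Probability.Probability" "HOL-Library.Landau_Symbols"
begin

section \<open>The exponential-type family\<close>

definition exp_support :: "real \<Rightarrow> ereal \<Rightarrow> real set" where
  "exp_support x0 xF = {x. x0 \<le> x \<and> ereal x < xF}"

text \<open>
  Only the values of \<open>\<phi>\<close> on the support are constrained. The limit as the argument increases to the
  endpoint is taken in \<open>ereal\<close>, so that finite and infinite endpoints are covered uniformly.
\<close>

definition exp_type_family :: "real \<Rightarrow> real \<Rightarrow> ereal \<Rightarrow> (real \<Rightarrow> real) \<Rightarrow> bool" where
  "exp_type_family \<theta> x0 xF \<phi> \<longleftrightarrow>
     0 < \<theta> \<and> 0 \<le> x0 \<and> ereal x0 < xF \<and>
     strict_mono_on (exp_support x0 xF) \<phi> \<and>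
     bij_betw \<phi> (exp_support x0 xF) {0..} \<and>
     \<phi> x0 = 0 \<and>
     filterlim (\<lambda>x. \<phi> (real_of_ereal x)) at_top (at_left xF)"

definition exp_inverse :: "real \<Rightarrow> ereal \<Rightarrow> (real \<Rightarrow> real) \<Rightarrow> real \<Rightarrow> real" where
  "exp_inverse x0 xF \<phi> = inv_into (exp_support x0 xF) \<phi>"

definition exp_cdf :: "real \<Rightarrow> real \<Rightarrow> ereal \<Rightarrow> (real \<Rightarrow> real) \<Rightarrow> real \<Rightarrow> real" where
  "exp_cdf \<theta> x0 xF \<phi> x =
     (if x < x0 then 0 else if ereal x < xF then 1 - exp (- \<theta> * \<phi> x) else 1)"

text \<open>
  No separate condition \<open>\<psi>' y \<noteq> 0\<close> is imposed for the quotient \<open>\<psi>''/\<psi>'\<close>: since \<open>\<psi>\<close> is strictly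
  increasing, the convergence below (with \<open>z / 0 = 0\<close>) already forces \<open>\<psi>' > 0\<close> for all large
  arguments.  Indeed \<open>\<psi>' \<ge> 0\<close>, so \<open>\<psi>''\<close> vanishes wherever \<open>\<psi>'\<close> does, and hence
  \<open>\<bar>\<psi>''\<bar> \<le> K \<psi>'\<close> eventually; a zero of \<open>\<psi>'\<close> would then make \<open>\<psi>'\<close> vanish identically beyond it.
\<close>

definition unbounded_endpoint_regular ::
    "real \<Rightarrow> real \<Rightarrow> ereal \<Rightarrow> (real \<Rightarrow> real) \<Rightarrow> real \<Rightarrow> real \<Rightarrow> bool" where
  "unbounded_endpoint_regular \<theta> x0 xF \<phi> c c' \<longleftrightarrow>
     (let \<psi> = exp_inverse x0 xF \<phi> in
        xF = \<infinity> \<and>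
        (\<forall>\<^sub>F y in at_top. \<psi> differentiable (at y) \<and> deriv \<psi> differentiable (at y)) \<and>
        c \<in> {0..<\<theta>} \<and> c' \<in> {0..<\<theta>} \<and>
        ((\<lambda>y. deriv \<psi> y / \<psi> y) \<longlongrightarrow> c) at_top \<and>
        ((\<lambda>y. deriv (deriv \<psi>) y / deriv \<psi> y) \<longlongrightarrow> c') at_top)"


section \<open>The stopping problem\<close>

definition iid_sample :: "'a measure \<Rightarrow> (nat \<Rightarrow> 'a \<Rightarrow> real) \<Rightarrow> nat \<Rightarrow> (real \<Rightarrow> real) \<Rightarrow> bool" where
  "iid_sample M X n F \<longleftrightarrow>
     prob_space M \<and>
     prob_space.indep_vars M (\<lambda>_. borel) X {1..n} \<and>
     (\<forall>t\<in>{1..n}. cdf (distr M borel (X t)) = F)"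

definition natural_filtration :: "'a measure \<Rightarrow> (nat \<Rightarrow> 'a \<Rightarrow> real) \<Rightarrow> nat \<Rightarrow> 'a measure" where
  "natural_filtration M X t =
     sigma (space M) {X s -` A \<inter> space M | s A. s \<in> {1..t} \<and> A \<in> sets borel}"

text \<open>
  For a \<open>{1..n+1}\<close>-valued time the stopping condition at instants \<open>t \<ge> n + 1\<close> is trivially true, so
  \<open>X t\<close> with \<open>t > n\<close> plays no role in the following definitions.
\<close>

definition policy :: "'a measure \<Rightarrow> (nat \<Rightarrow> 'a \<Rightarrow> real) \<Rightarrow> nat \<Rightarrow> ('a \<Rightarrow> nat) \<Rightarrow> bool" where
  "policy M X n \<tau> \<longleftrightarrow>
     (\<forall>\<omega>\<in>space M. \<tau> \<omega> \<in> {1..n+1}) \<and> stopping_time (natural_filtration M X) \<tau>"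

definition expected_reward :: "'a measure \<Rightarrow> (nat \<Rightarrow> 'a \<Rightarrow> real) \<Rightarrow> nat \<Rightarrow> ('a \<Rightarrow> nat) \<Rightarrow> real" where
  "expected_reward M X n \<tau> = (LINT \<omega>|M. (if \<tau> \<omega> = n + 1 then 0 else X (\<tau> \<omega>) \<omega>))"

definition optimal_policy :: "'a measure \<Rightarrow> (nat \<Rightarrow> 'a \<Rightarrow> real) \<Rightarrow> nat \<Rightarrow> ('a \<Rightarrow> nat) \<Rightarrow> bool" where
  "optimal_policy M X n \<tau> \<longleftrightarrow>
     policy M X n \<tau> \<and>
     (\<forall>\<sigma>. policy M X n \<sigma> \<longrightarrow> expected_reward M X n \<sigma> \<le> expected_reward M X n \<tau>)"

definition OPT :: "'a measure \<Rightarrow> (nat \<Rightarrow> 'a \<Rightarrow> real) \<Rightarrow> nat \<Rightarrow> real" where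
  "OPT M X n = (LINT \<omega>|M. (MAX t\<in>{1..n}. X t \<omega>))"

definition CR :: "'a measure \<Rightarrow> (nat \<Rightarrow> 'a \<Rightarrow> real) \<Rightarrow> nat \<Rightarrow> ('a \<Rightarrow> nat) \<Rightarrow> real" where
  "CR M X n \<tau> = expected_reward M X n \<tau> / OPT M X n"

end

theory Submission
  imports Defs
begin

text \<open>
  In the coordinate \<open>y = \<phi> x\<close> everything rests on the increments of \<open>ln \<psi>\<close>: since \<open>\<psi>' / \<psi>\<close> tends to
  \<open>c\<close>, \<open>\<psi> (y + s) / \<psi> y\<close> tends to \<open>exp (c * s)\<close>, with an integrable majorant because \<open>c < \<theta>\<close>.
  A sample is \<open>\<psi> (- ln U / \<theta>)\<close> with \<open>U\<close> uniform and the maximum is the same function of the minimum of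
  \<open>n\<close> uniforms; rescaling by \<open>n\<close>, dominated convergence turns its mean into the Gamma integral.

  The optimal reward is \<open>v n\<close>, where \<open>v 0 = 0\<close> and \<open>v (k + 1) = v k + E (X - v k)\<^sup>+\<close>. Dominated convergence
  gives \<open>E (X - \<psi> y)\<^sup>+\<close> asymptotic to \<open>c / (\<theta> - c) * \<psi> y * exp (- \<theta> * y)\<close>. If \<open>c > 0\<close>, this makes the
  increments of \<open>exp (\<theta> * \<phi> (v k))\<close> converge to \<open>\<theta> / (\<theta> - c)\<close>, so \<open>v n\<close> is close to
  \<open>\<psi> (ln (n * \<theta> / (\<theta> - c)) / \<theta>)\<close>. If \<open>c = 0\<close>, the bound \<open>v n \<le> w + n * E (X - w)\<^sup>+\<close> with
  \<open>w = \<psi> (ln n / \<theta>)\<close> matches the reward of a static threshold.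
\<close>

section \<open>Integrals and averages\<close>

text \<open>Closed forms are available as gauge integrals, while dominated convergence needs
  Lebesgue integrals; for a nonnegative integrand the two agree.\<close>

lemma has_bochner_integral_indicator_nonneg:
  fixes f :: "real \<Rightarrow> real"
  assumes [measurable]: "f \<in> borel_measurable borel" "S \<in> sets borel"
    and nonneg: "\<And>x. x \<in> S \<Longrightarrow> 0 \<le> f x" and I: "(f has_integral I) S"
  shows "has_bochner_integral lborel (\<lambda>x. indicator S x * f x) I"
proof (rule has_bochner_integral_nn_integral)
  show "(\<lambda>x. indicator S x * f x) \<in> borel_measurable lborel" by measurable
  show "AE x in lborel. 0 \<le> indicator S x * f x"
    using nonneg by (auto split: split_indicator)
  show "0 \<le> I" using has_integral_nonneg[OF I nonneg] .
  show "(\<integral>\<^sup>+x. ennreal (indicator S x * f x) \<partial>lborel) = ennreal I"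
    using nn_integral_has_integral_lebesgue[OF nonneg I] .
qed

lemma has_bochner_integral_powr_unit:
  assumes "a > (-1::real)"
  shows "has_bochner_integral lborel (\<lambda>r. indicator {0<..<1} r * r powr a) (1 / (a + 1))"
proof (rule has_bochner_integral_indicator_nonneg)
  have "((\<lambda>r. r powr a) has_integral (1 / (a + 1))) {0..1}"
    using has_integral_powr_from_0[OF assms, of 1] by simp
  then show "((\<lambda>r. r powr a) has_integral (1 / (a + 1))) {0<..<1}"
    by (simp add: has_integral_Icc_iff_Ioo)
qed auto

lemma has_bochner_integral_Gamma:
  assumes "a < (1::real)"
  shows "has_bochner_integral lborel (\<lambda>t. indicator {0<..} t * (t powr (-a) * exp (-t))) (Gamma (1 - a))"
proof (rule has_bochner_integral_indicator_nonneg)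
  have *: "((\<lambda>t. t powr (-a) * exp (-t)) has_integral Gamma (1 - a)) {0..}"
    using Gamma_integral_real[of "1 - a"] assms by (simp add: exp_minus field_simps)
  show "((\<lambda>t. t powr (-a) * exp (-t)) has_integral Gamma (1 - a)) {0<..}"
    by (rule iffD1[OF has_integral_spike_set_eq *]) (auto intro: negligible_subset[of "{0::real}"])
qed auto

text \<open>Telescoping: from some \<open>N\<close> on every increment is within
  \<open>r / 2\<close> of \<open>l\<close>, so \<open>a n - l * n\<close> is at most
  \<open>r / 2 * (n - N)\<close> plus a fixed constant, and the constant is negligible against
  \<open>n\<close>.\<close>

lemma LIMSEQ_div_of_increments:
  fixes a :: "nat \<Rightarrow> real"
  assumes "(\<lambda>k. a (Suc k) - a k) \<longlonglongrightarrow> l"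
  shows "(\<lambda>n. a n / real n) \<longlonglongrightarrow> l"
proof (rule LIMSEQ_I)
  fix r :: real assume "r > 0"
  then obtain N where N: "\<And>k. k \<ge> N \<Longrightarrow> norm (a (Suc k) - a k - l) < r / 2"
    using LIMSEQ_D[OF assms, of "r / 2"] by auto
  have incr: "\<bar>a n - a N - l * (real n - real N)\<bar> \<le> r / 2 * (real n - real N)" if "n \<ge> N" for n
    using that
  proof (induction n rule: dec_induct)
    case (step m)
    have "a (Suc m) - a N - l * (real (Suc m) - real N)
        = (a (Suc m) - a m - l) + (a m - a N - l * (real m - real N))"
      by (simp add: algebra_simps)
    also have "\<bar>\<dots>\<bar> \<le> r / 2 + r / 2 * (real m - real N)"
      using abs_triangle_ineq step.IH N[OF step.hyps(1)] by (intro order_trans[OF abs_triangle_ineq] add_mono) auto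
    also have "\<dots> = r / 2 * (real (Suc m) - real N)"
      by (simp add: algebra_simps add_divide_distrib diff_divide_distrib)
    finally show ?case .
  qed simp
  have "(\<lambda>n. \<bar>a N - l * real N\<bar> / real n) \<longlonglongrightarrow> 0"
    by real_asymp
  then have "eventually (\<lambda>n. \<bar>a N - l * real N\<bar> / real n < r / 2) sequentially"
    using \<open>r > 0\<close> by (intro order_tendstoD) auto
  then have "eventually (\<lambda>n. norm (a n / real n - l) < r) sequentially"
    using eventually_ge_at_top[of N] eventually_gt_at_top[of 0]
  proof eventually_elim
    case (elim n)
    have "\<bar>a n - l * real n\<bar> \<le> r / 2 * (real n - real N) + \<bar>a N - l * real N\<bar>"
    proof -
      have "a n - l * real n = (a n - a N - l * (real n - real N)) + (a N - l * real N)"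
        by (simp add: algebra_simps)
      then show ?thesis
        using incr[OF elim(2)] abs_triangle_ineq[of "a n - a N - l * (real n - real N)" "a N - l * real N"]
        by linarith
    qed
    also have "\<dots> < r / 2 * real n + r / 2 * real n"
    proof (rule add_le_less_mono)
      show "r / 2 * (real n - real N) \<le> r / 2 * real n" using \<open>r > 0\<close> by simp
      show "\<bar>a N - l * real N\<bar> < r / 2 * real n" using elim by (simp add: pos_divide_less_eq)
    qed
    finally have "\<bar>a n - l * real n\<bar> < r * real n" by (simp add: field_simps)
    moreover have "a n / real n - l = (a n - l * real n) / real n"
      using elim(3) by (simp add: field_simps)
    ultimately show ?case
      using elim(3) by (simp add: abs_divide pos_divide_less_eq)
  qed
  then show "\<exists>no. \<forall>n\<ge>no. norm (a n / real n - l) < r"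
    by (simp add: eventually_sequentially)
qed

section \<open>The quantile function\<close>

text \<open>\<open>log_increment\<close> is the derivative-free form of
  \<open>\<psi>' / \<psi>\<close> tending to \<open>c\<close>: between any two points beyond
  \<open>Y\<close> the slope of \<open>ln \<psi>\<close> is within \<open>\<epsilon>\<close> of
  \<open>c\<close>. The endpoint is infinite, so \<open>\<phi>\<close> and \<open>\<psi>\<close> are
  inverse to each other between \<open>{x0..}\<close> and \<open>{0..}\<close>.\<close>

locale exp_quantile =
  fixes \<theta> c x0 :: real and \<phi> \<psi> :: "real \<Rightarrow> real"
  assumes theta_pos: "0 < \<theta>" and c_nonneg: "0 \<le> c" and c_less: "c < \<theta>" and x0_nonneg: "0 \<le> x0"
    and psi_ge: "\<And>y. 0 \<le> y \<Longrightarrow> x0 \<le> \<psi> y"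
    and phi_nonneg: "\<And>x. x0 \<le> x \<Longrightarrow> 0 \<le> \<phi> x"
    and psi_phi: "\<And>x. x0 \<le> x \<Longrightarrow> \<psi> (\<phi> x) = x"
    and phi_psi: "\<And>y. 0 \<le> y \<Longrightarrow> \<phi> (\<psi> y) = y"
    and phi_le_iff: "\<And>x y. x0 \<le> x \<Longrightarrow> x0 \<le> y \<Longrightarrow> \<phi> x \<le> \<phi> y \<longleftrightarrow> x \<le> y"
    and log_increment: "\<And>\<epsilon>. 0 < \<epsilon> \<Longrightarrow>
      \<exists>Y>0. \<forall>y\<ge>Y. \<forall>z\<ge>Y. \<bar>ln (\<psi> z) - ln (\<psi> y) - c * (z - y)\<bar> \<le> \<epsilon> * \<bar>z - y\<bar>"
begin

section \<open>Order and growth of \<open>\<psi>\<close>\<close>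

lemma psi_le_psi_iff: "0 \<le> y \<Longrightarrow> 0 \<le> z \<Longrightarrow> \<psi> y \<le> \<psi> z \<longleftrightarrow> y \<le> z"
  using phi_le_iff[of "\<psi> y" "\<psi> z"] by (simp add: psi_ge phi_psi)

lemma psi_less_psi_iff: "0 \<le> y \<Longrightarrow> 0 \<le> z \<Longrightarrow> \<psi> y < \<psi> z \<longleftrightarrow> y < z"
  using psi_le_psi_iff[of z y] by (simp add: not_le[symmetric])

lemma psi_le_iff: "0 \<le> y \<Longrightarrow> x0 \<le> x \<Longrightarrow> \<psi> y \<le> x \<longleftrightarrow> y \<le> \<phi> x"
  using phi_le_iff[of "\<psi> y" x] by (simp add: psi_ge phi_psi)

lemma psi_nonneg: "0 \<le> y \<Longrightarrow> 0 \<le> \<psi> y"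
  using psi_ge[of y] x0_nonneg by simp

lemma psi_pos: "0 < y \<Longrightarrow> 0 < \<psi> y"
  using psi_less_psi_iff[of 0 y] psi_nonneg[of 0] by simp

lemma log_psi_diff_tendsto:
  assumes y: "filterlim y at_top F" and zy: "((\<lambda>x. z x - y x) \<longlongrightarrow> s) F"
  shows "((\<lambda>x. ln (\<psi> (z x)) - ln (\<psi> (y x))) \<longlongrightarrow> c * s) F"
proof -
  have z: "filterlim z at_top F"
    using filterlim_tendsto_add_at_top[OF zy y] by simp
  have "((\<lambda>x. ln (\<psi> (z x)) - ln (\<psi> (y x)) - c * (z x - y x)) \<longlongrightarrow> 0) F"
  proof (rule tendstoI)
    fix e :: real assume "e > 0"
    \<comment> \<open>Eventually \<open>z - y\<close> is bounded by
      \<open>\<bar>s\<bar> + 1\<close>, so this choice keeps the error below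
      \<open>e / 2\<close>.\<close>
    define \<epsilon> where "\<epsilon> = e / (2 * (\<bar>s\<bar> + 1))"
    have "\<epsilon> > 0" using \<open>e > 0\<close> by (simp add: \<epsilon>_def field_simps)
    then obtain Y where Y: "\<And>y z. y \<ge> Y \<Longrightarrow> z \<ge> Y \<Longrightarrow>
        \<bar>ln (\<psi> z) - ln (\<psi> y) - c * (z - y)\<bar> \<le> \<epsilon> * \<bar>z - y\<bar>"
      using log_increment by meson
    have "eventually (\<lambda>x. dist (z x - y x) s < 1) F"
      using tendstoD[OF zy] by simp
    moreover have "eventually (\<lambda>x. y x \<ge> Y) F" "eventually (\<lambda>x. z x \<ge> Y) F"
      using y z by (simp_all add: filterlim_at_top)
    ultimately show "eventually (\<lambda>x. dist (ln (\<psi> (z x)) - ln (\<psi> (y x)) - c * (z x - y x)) 0 < e) F"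
    proof eventually_elim
      case (elim x)
      have "\<bar>ln (\<psi> (z x)) - ln (\<psi> (y x)) - c * (z x - y x)\<bar> \<le> \<epsilon> * \<bar>z x - y x\<bar>"
        using Y elim by blast
      also have "\<dots> \<le> \<epsilon> * (\<bar>s\<bar> + 1)"
        using elim(1) \<open>\<epsilon> > 0\<close> by (intro mult_left_mono) (auto simp: dist_real_def)
      also have "\<dots> = e / 2" by (simp add: \<epsilon>_def field_simps)
      also have "\<dots> < e" using \<open>e > 0\<close> by simp
      finally show ?case by simp
    qed
  qed
  from tendsto_add[OF this tendsto_mult_left[OF zy, of c]] show ?thesis by simp
qed

text \<open>Exponentiated form of the previous limit; it expresses that \<open>\<psi> (ln x)\<close>
  varies regularly in \<open>x\<close> with index \<open>c\<close>.\<close>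

lemma psi_ratio_tendsto:
  assumes y: "filterlim y at_top F" and zy: "((\<lambda>x. z x - y x) \<longlongrightarrow> s) F"
  shows "((\<lambda>x. \<psi> (z x) / \<psi> (y x)) \<longlongrightarrow> exp (c * s)) F"
proof -
  have z: "filterlim z at_top F"
    using filterlim_tendsto_add_at_top[OF zy y] by simp
  have "eventually (\<lambda>x. 0 < y x) F" "eventually (\<lambda>x. 0 < z x) F"
    using y z by (simp_all add: filterlim_at_top_dense)
  then have "eventually (\<lambda>x. exp (ln (\<psi> (z x)) - ln (\<psi> (y x))) = \<psi> (z x) / \<psi> (y x)) F"
    by eventually_elim (simp add: exp_diff psi_pos)
  then show ?thesis
    by (rule Lim_transform_eventually[OF tendsto_exp[OF log_psi_diff_tendsto[OF y zy]]])
qed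

text \<open>Any rate strictly between \<open>c\<close> and \<open>\<theta>\<close> works, and the
  midpoint is taken. A rate below \<open>\<theta>\<close> is what makes the majorants further down
  integrable.\<close>

lemma psi_growth:
  obtains d Y where "0 < d" "d < \<theta>" "0 < Y"
    "\<And>y z. Y \<le> y \<Longrightarrow> y \<le> z \<Longrightarrow> \<psi> z \<le> \<psi> y * exp (d * (z - y))"
proof -
  define d where "d = (c + \<theta>) / 2"
  have d: "0 < d" "d < \<theta>" "c < d" using theta_pos c_nonneg c_less by (auto simp: d_def)
  obtain Y where "Y > 0" and Y: "\<And>y z. y \<ge> Y \<Longrightarrow> z \<ge> Y \<Longrightarrow>
      \<bar>ln (\<psi> z) - ln (\<psi> y) - c * (z - y)\<bar> \<le> (d - c) * \<bar>z - y\<bar>"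
    using log_increment[of "d - c"] d by auto
  have "\<psi> z \<le> \<psi> y * exp (d * (z - y))" if "Y \<le> y" "y \<le> z" for y z
  proof -
    have "ln (\<psi> z) \<le> ln (\<psi> y) + d * (z - y)"
      using Y[of y z] that by (auto simp: algebra_simps abs_le_iff)
    then have "exp (ln (\<psi> z)) \<le> exp (ln (\<psi> y) + d * (z - y))"
      by (simp only: exp_le_cancel_iff)
    moreover have "0 < \<psi> y" "0 < \<psi> z" using \<open>Y > 0\<close> that by (auto intro!: psi_pos)
    ultimately show ?thesis by (simp add: exp_add)
  qed
  then show ?thesis using that d \<open>Y > 0\<close> by blast
qed

section \<open>The quantile function of a sample\<close>

definition \<Psi> :: "real \<Rightarrow> real" where "\<Psi> y = \<psi> (max 0 y)"

text \<open>For \<open>U\<close> uniform on the unit interval, \<open>- ln U / \<theta>\<close> is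
  exponential with rate \<open>\<theta>\<close>, so \<open>quantile U\<close> has the law of a
  sample. Large samples correspond to small \<open>u\<close>.\<close>

definition quantile :: "real \<Rightarrow> real" where "quantile u = \<Psi> (- ln u / \<theta>)"

text \<open>Cutting the argument off at 0 yields a function that is monotone on the whole line,
  hence Borel.\<close>

lemma measurable_Psi [measurable]: "\<Psi> \<in> borel_measurable borel"
  by (intro borel_measurable_mono monoI) (auto simp: \<Psi>_def psi_le_psi_iff)

lemma measurable_quantile [measurable]: "quantile \<in> borel_measurable borel"
  unfolding quantile_def by measurable

lemma quantile_eq: "0 < u \<Longrightarrow> u \<le> 1 \<Longrightarrow> quantile u = \<psi> (- ln u / \<theta>)"
  using theta_pos by (auto simp: quantile_def \<Psi>_def max_def field_simps)

lemma quantile_ge: "x0 \<le> quantile u"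
  by (simp add: quantile_def \<Psi>_def psi_ge)

lemma quantile_nonneg: "0 \<le> quantile u"
  using quantile_ge[of u] x0_nonneg by simp

lemma quantile_le_iff:
  assumes "0 < u" "u \<le> 1" "x0 \<le> x"
  shows "quantile u \<le> x \<longleftrightarrow> exp (- \<theta> * \<phi> x) \<le> u"
proof -
  have "quantile u \<le> x \<longleftrightarrow> - ln u / \<theta> \<le> \<phi> x"
    using assms theta_pos psi_le_iff[of "- ln u / \<theta>" x] by (simp add: quantile_eq field_simps)
  also have "\<dots> \<longleftrightarrow> - \<theta> * \<phi> x \<le> ln u"
    by (subst pos_divide_le_eq[OF theta_pos]) (simp add: mult.commute, linarith)
  also have "\<dots> \<longleftrightarrow> exp (- \<theta> * \<phi> x) \<le> u"
    using assms by (simp add: ln_ge_iff)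
  finally show ?thesis .
qed

text \<open>With \<open>y = - ln u / \<theta>\<close>, growth at rate \<open>d\<close> turns into
  the power \<open>u powr (- (d / \<theta>))\<close>, integrable at 0 since
  \<open>d < \<theta>\<close>. Where \<open>y < Y\<close>, monotonicity bounds the quantile by
  \<open>\<psi> Y\<close>, and the power is at least 1.\<close>

lemma quantile_bound:
  obtains \<beta> K where "0 < \<beta>" "\<beta> < 1" "\<And>u. 0 < u \<Longrightarrow> u \<le> 1 \<Longrightarrow> quantile u \<le> K * u powr (- \<beta>)"
proof -
  obtain d Y where d: "0 < d" "d < \<theta>" "0 < Y"
    and Y: "\<And>y z. Y \<le> y \<Longrightarrow> y \<le> z \<Longrightarrow> \<psi> z \<le> \<psi> y * exp (d * (z - y))"
    by (rule psi_growth) blast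
  have "quantile u \<le> \<psi> Y * u powr (- (d / \<theta>))" if u: "0 < u" "u \<le> 1" for u
  proof (cases "Y \<le> - ln u / \<theta>")
    case True
    have "quantile u \<le> \<psi> Y * exp (d * (- ln u / \<theta> - Y))"
      unfolding quantile_eq[OF u] by (rule Y[OF order_refl True])
    also have "\<dots> \<le> \<psi> Y * exp (d * (- ln u / \<theta>))"
    proof (intro mult_left_mono)
      show "exp (d * (- ln u / \<theta> - Y)) \<le> exp (d * (- ln u / \<theta>))"
        using d by (simp add: algebra_simps)
      show "0 \<le> \<psi> Y" using d by (simp add: psi_nonneg)
    qed
    also have "\<dots> = \<psi> Y * u powr (- (d / \<theta>))"
      using u by (simp add: powr_def field_simps)
    finally show ?thesis .
  next
    case False
    then have "quantile u \<le> \<psi> Y * 1"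
      using u d theta_pos by (simp add: quantile_eq psi_le_psi_iff field_simps)
    also have "\<dots> \<le> \<psi> Y * u powr (- (d / \<theta>))"
    proof (rule mult_left_mono)
      have "u powr (d / \<theta>) \<le> 1" using u d theta_pos by (intro powr_le1) auto
      then show "1 \<le> u powr - (d / \<theta>)" using u by (simp add: powr_minus one_le_inverse)
      show "0 \<le> \<psi> Y" using d by (simp add: psi_nonneg)
    qed
    finally show ?thesis .
  qed
  then show ?thesis
    using that[of "d / \<theta>" "\<psi> Y"] d theta_pos by simp
qed

lemma integrable_quantile: "integrable lborel (\<lambda>u. indicator {0<..<1} u * quantile u)"
proof -
  obtain \<beta> K where \<beta>: "0 < \<beta>" "\<beta> < 1" and K: "\<And>u. 0 < u \<Longrightarrow> u \<le> 1 \<Longrightarrow> quantile u \<le> K * u powr (- \<beta>)"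
    by (rule quantile_bound) blast
  show ?thesis
  proof (rule Bochner_Integration.integrable_bound)
    have "integrable lborel (\<lambda>u. indicator {0<..<1} u * u powr (- \<beta>))"
      using has_bochner_integral_powr_unit[of "- \<beta>"] \<beta> by (simp add: has_bochner_integral_iff)
    then show "integrable lborel (\<lambda>u. K * (indicator {0<..<1} u * u powr (- \<beta>)))"
      by (rule integrable_mult_right)
    show "AE u in lborel. norm (indicator {0<..<1} u * quantile u)
        \<le> norm (K * (indicator {0<..<1} u * u powr (- \<beta>)))"
    proof (rule AE_I2)
      fix u :: real
      show "norm (indicator {0<..<1} u * quantile u) \<le> norm (K * (indicator {0<..<1} u * u powr (- \<beta>)))"
        using K[of u] quantile_nonneg[of u] by (auto split: split_indicator)
    qed
  qed measurable
qed


section \<open>Mean excess of a sample over a threshold\<close>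

lemma integrable_quantile_of_bound:
  assumes [measurable]: "f \<in> borel_measurable borel"
    and "\<And>u. 0 < u \<Longrightarrow> u < 1 \<Longrightarrow> \<bar>f u\<bar> \<le> quantile u + K"
  shows "integrable lborel (\<lambda>u. indicator {0<..<1} u * f u)"
proof (rule Bochner_Integration.integrable_bound)
  have "integrable lborel (\<lambda>u. indicator {0<..<1::real} u * K)" by simp
  with integrable_quantile
  show "integrable lborel (\<lambda>u. indicator {0<..<1} u * quantile u + indicator {0<..<1} u * K)"
    by (rule Bochner_Integration.integrable_add)
  show "AE u in lborel. norm (indicator {0<..<1} u * f u)
      \<le> norm (indicator {0<..<1} u * quantile u + indicator {0<..<1} u * K)"
    using assms(2) by (intro AE_I2) (fastforce split: split_indicator)
qed measurable

text \<open>For a sample \<open>X\<close> this is \<open>E (X - w)\<^sup>+\<close>, the mean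
  improvement that one more observation brings over a guaranteed \<open>w\<close>.\<close>

definition excess :: "real \<Rightarrow> real" where
  "excess w = (\<integral>u. indicator {0<..<1} u * max (quantile u - w) 0 \<partial>lborel)"

lemma integrable_excess: "integrable lborel (\<lambda>u. indicator {0<..<1} u * max (quantile u - w) 0)"
proof (rule integrable_quantile_of_bound[where K = "\<bar>w\<bar>"])
  show "\<bar>max (quantile u - w) 0\<bar> \<le> quantile u + \<bar>w\<bar>" for u
    using quantile_nonneg[of u] by auto
qed measurable

lemma integrable_max_quantile: "integrable lborel (\<lambda>u. indicator {0<..<1} u * max (quantile u) w)"
proof (rule integrable_quantile_of_bound[where K = "\<bar>w\<bar>"])
  show "\<bar>max (quantile u) w\<bar> \<le> quantile u + \<bar>w\<bar>" for u
    using quantile_nonneg[of u] by auto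
qed measurable

lemma integral_max_quantile:
  "(\<integral>u. indicator {0<..<1} u * max (quantile u) w \<partial>lborel) = w + excess w"
proof -
  have "(\<integral>u. indicator {0<..<1} u * max (quantile u) w \<partial>lborel)
      = (\<integral>u. indicator {0<..<1} u * w + indicator {0<..<1} u * max (quantile u - w) 0 \<partial>lborel)"
    by (intro Bochner_Integration.integral_cong) (auto split: split_indicator)
  also have "\<dots> = w + excess w"
    unfolding excess_def
    by (subst Bochner_Integration.integral_add[OF _ integrable_excess]) simp_all
  finally show ?thesis .
qed

text \<open>The integrand vanishes from \<open>u = exp (- \<theta> * y)\<close> on. Substituting
  \<open>u = exp (- \<theta> * y) * r\<close> stretches the remaining interval to unit length, and
  the logarithm turns the scaling into a shift of the argument by \<open>y\<close>.\<close>

lemma excess_psi: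
  assumes "0 \<le> y"
  shows "excess (\<psi> y) = exp (- \<theta> * y) * (\<integral>r. indicator {0<..<1} r * (\<Psi> (y - ln r / \<theta>) - \<psi> y) \<partial>lborel)"
proof -
  define a where "a = exp (- \<theta> * y)"
  have a: "0 < a" "a \<le> 1" using assms theta_pos by (auto simp: a_def)
  have "excess (\<psi> y) = \<bar>a\<bar> *\<^sub>R (\<integral>r. indicator {0<..<1} (0 + a * r) * max (quantile (0 + a * r) - \<psi> y) 0 \<partial>lborel)"
    unfolding excess_def using a by (intro lborel_integral_real_affine) simp
  also have "(\<lambda>r. indicator {0<..<1} (0 + a * r) * max (quantile (0 + a * r) - \<psi> y) 0)
      = (\<lambda>r. indicator {0<..<1} r * (\<Psi> (y - ln r / \<theta>) - \<psi> y))"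
  proof
    fix r :: real
    have le: "quantile (a * r) \<le> \<psi> y \<longleftrightarrow> 1 \<le> r" if "0 < a * r" "a * r < 1"
    proof -
      have "quantile (a * r) \<le> \<psi> y \<longleftrightarrow> a \<le> a * r"
        using quantile_le_iff[of "a * r" "\<psi> y"] that assms by (simp add: psi_ge phi_psi a_def)
      then show ?thesis using a by simp
    qed
    have eq: "quantile (a * r) = \<Psi> (y - ln r / \<theta>)" if "0 < r"
    proof -
      have "ln (a * r) = - \<theta> * y + ln r"
        using that a by (simp add: ln_mult a_def)
      then have "- ln (a * r) / \<theta> = y - ln r / \<theta>"
        using theta_pos by (simp add: field_simps)
      then show ?thesis by (simp add: quantile_def)
    qed
    have "a * r < 1" if "r < 1" "0 < r"
      using that a mult_le_less_imp_less[of a 1 r 1] by simp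
    then show "indicator {0<..<1} (0 + a * r) * max (quantile (0 + a * r) - \<psi> y) 0
        = indicator {0<..<1} r * (\<Psi> (y - ln r / \<theta>) - \<psi> y)"
      using le eq a by (auto simp: zero_less_mult_iff not_le max_def split: split_indicator)
  qed
  finally show ?thesis using a by (simp add: a_def)
qed

text \<open>By \<open>excess_psi\<close> the quotient is the integral over the unit interval of
  \<open>\<psi> (y - ln r / \<theta>) / \<psi> y - 1\<close>. The integrand tends to
  \<open>r powr (- (c / \<theta>)) - 1\<close> and is dominated by
  \<open>r powr (- (d / \<theta>))\<close>.\<close>

lemma excess_asymp:
  "((\<lambda>y. excess (\<psi> y) * exp (\<theta> * y) / \<psi> y) \<longlongrightarrow> c / (\<theta> - c)) at_top"
proof -
  obtain d Y where d: "0 < d" "d < \<theta>" "0 < Y"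
    and Y: "\<And>y z. Y \<le> y \<Longrightarrow> y \<le> z \<Longrightarrow> \<psi> z \<le> \<psi> y * exp (d * (z - y))"
    by (rule psi_growth) blast
  define s where "s y r = indicator {0<..<1} r * (\<Psi> (y - ln r / \<theta>) / \<psi> y - 1)" for y r :: real
  define w where "w r = indicator {0<..<1} r * r powr (- (d / \<theta>))" for r :: real
  define g where "g r = indicator {0<..<1} r * r powr (- (c / \<theta>)) - indicator {0<..<1} r" for r :: real
  have frac: "d / \<theta> < 1" "c / \<theta> < 1" using d theta_pos c_less by auto
  have Psi_eq: "\<Psi> (y - ln r / \<theta>) = \<psi> (y - ln r / \<theta>)" and ge: "y \<le> y - ln r / \<theta>"
    if "0 < r" "r < 1" "0 \<le> y" for r y
  proof -
    have "ln r / \<theta> \<le> 0" using that theta_pos by (simp add: divide_le_0_iff)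
    then show "y \<le> y - ln r / \<theta>" "\<Psi> (y - ln r / \<theta>) = \<psi> (y - ln r / \<theta>)"
      using that by (auto simp: \<Psi>_def max_def)
  qed
  have "((\<lambda>y. integral\<^sup>L lborel (s y)) \<longlongrightarrow> integral\<^sup>L lborel g) at_top"
  proof (rule integral_dominated_convergence_at_top)
    show "g \<in> borel_measurable lborel" unfolding g_def by measurable
    show "s y \<in> borel_measurable lborel" for y unfolding s_def by measurable
    show "integrable lborel w"
      using has_bochner_integral_powr_unit[of "- (d / \<theta>)"] frac
      by (simp add: has_bochner_integral_iff w_def[abs_def])
    show "\<forall>\<^sub>F y in at_top. AE r in lborel. norm (s y r) \<le> w r"
      using eventually_ge_at_top[of Y]
    proof eventually_elim
      case (elim y)
      have "norm (s y r) \<le> w r" for r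
      proof (cases "0 < r \<and> r < 1")
        case True
        have "\<psi> y > 0" using elim d by (intro psi_pos) simp
        have "\<psi> (y - ln r / \<theta>) \<le> \<psi> y * exp (d * (- ln r / \<theta>))"
          using Y[OF elim, of "y - ln r / \<theta>"] ge[of r y] True elim d by simp
        also have "exp (d * (- ln r / \<theta>)) = r powr (- (d / \<theta>))"
          using True by (simp add: powr_def)
        finally have "\<psi> (y - ln r / \<theta>) / \<psi> y \<le> r powr (- (d / \<theta>))"
          using \<open>\<psi> y > 0\<close> by (simp add: pos_divide_le_eq mult.commute)
        \<comment> \<open>The ratio being at least 1, subtracting 1 leaves a nonnegative number, so
          the upper bound also bounds the norm.\<close>
        moreover have "1 \<le> \<psi> (y - ln r / \<theta>) / \<psi> y"
          using \<open>\<psi> y > 0\<close> ge[of r y] True elim d by (simp add: psi_le_psi_iff)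
        ultimately show ?thesis
          using True Psi_eq[of r y] elim d by (simp add: s_def w_def)
      qed (auto simp: s_def w_def)
      then show ?case by simp
    qed
    show "AE r in lborel. ((\<lambda>y. s y r) \<longlongrightarrow> g r) at_top"
    proof (rule AE_I2)
      fix r :: real
      show "((\<lambda>y. s y r) \<longlongrightarrow> g r) at_top"
      proof (cases "0 < r \<and> r < 1")
        case True
        have "((\<lambda>y. \<psi> (y - ln r / \<theta>) / \<psi> y - 1) \<longlongrightarrow> exp (c * (- ln r / \<theta>)) - 1) at_top"
          by (intro tendsto_intros psi_ratio_tendsto filterlim_ident) simp
        moreover have "exp (c * (- ln r / \<theta>)) = r powr (- (c / \<theta>))"
          using True by (simp add: powr_def)
        moreover have "\<forall>\<^sub>F y in at_top. \<psi> (y - ln r / \<theta>) / \<psi> y - 1 = s y r"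
          using eventually_ge_at_top[of 0]
          by eventually_elim (use True Psi_eq in \<open>simp add: s_def\<close>)
        ultimately show ?thesis
          using True by (simp add: g_def tendsto_cong)
      qed (auto simp: s_def g_def)
    qed
  qed
  also have "integral\<^sup>L lborel g = 1 / (1 - c / \<theta>) - 1"
    unfolding g_def using has_bochner_integral_powr_unit[of "- (c / \<theta>)"] frac
    by (subst Bochner_Integration.integral_diff) (simp_all add: has_bochner_integral_iff)
  also have "\<dots> = c / (\<theta> - c)"
    using theta_pos c_less by (simp add: field_simps)
  finally have "((\<lambda>y. integral\<^sup>L lborel (s y)) \<longlongrightarrow> c / (\<theta> - c)) at_top" .
  moreover have "\<forall>\<^sub>F y in at_top. integral\<^sup>L lborel (s y) = excess (\<psi> y) * exp (\<theta> * y) / \<psi> y"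
    using eventually_gt_at_top[of 0]
  proof eventually_elim
    case (elim y)
    have "s y = (\<lambda>r. indicator {0<..<1} r * (\<Psi> (y - ln r / \<theta>) - \<psi> y) / \<psi> y)"
      using psi_pos[OF elim] by (auto simp: s_def field_simps)
    then have "integral\<^sup>L lborel (s y)
        = (\<integral>r. indicator {0<..<1} r * (\<Psi> (y - ln r / \<theta>) - \<psi> y) \<partial>lborel) / \<psi> y"
      by simp
    then show ?case
      using excess_psi[of y] elim by (simp add: exp_minus)
  qed
  ultimately show ?thesis by (rule Lim_transform_eventually)
qed

section \<open>The mean of the maximum\<close>

lemma quantile_scale:
  "0 < t \<Longrightarrow> 0 < n \<Longrightarrow> quantile (t / n) = \<Psi> (ln n / \<theta> - ln t / \<theta>)"
  by (simp add: quantile_def ln_div diff_divide_distrib)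

text \<open>From \<open>1 - x \<le> exp (- x)\<close>; the factor \<open>exp 1\<close> pays for the
  exponent \<open>n - 1\<close> in place of \<open>n\<close>.\<close>

lemma one_minus_power_le:
  fixes t :: real
  assumes "0 \<le> t" "t \<le> real n" "1 \<le> n"
  shows "(1 - t / real n) ^ (n - 1) \<le> exp 1 * exp (- t)"
proof -
  have "(1 - t / real n) ^ (n - 1) \<le> exp (- (t / real n)) ^ (n - 1)"
    using assms exp_ge_add_one_self[of "- (t / real n)"] by (intro power_mono) auto
  also have "\<dots> = exp (- t + t / real n)"
    using assms by (simp add: exp_of_nat_mult[symmetric] of_nat_diff field_simps)
  also have "\<dots> \<le> exp (1 - t)"
    using assms by (simp add: divide_le_eq)
  finally show ?thesis by (simp add: exp_diff exp_minus field_simps)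
qed

lemma one_minus_power_tendsto: "(\<lambda>n. (1 - t / real n) ^ (n - 1)) \<longlonglongrightarrow> exp (- t)" for t :: real
proof -
  have "(\<lambda>n. (1 + (- t) / real n) ^ n / (1 + (- t) / real n)) \<longlonglongrightarrow> exp (- t) / (1 + 0)"
    by (intro tendsto_divide tendsto_exp_limit_sequentially tendsto_add tendsto_const
        real_tendsto_divide_at_top filterlim_real_sequentially) auto
  moreover have "\<forall>\<^sub>F n in sequentially.
      (1 + (- t) / real n) ^ n / (1 + (- t) / real n) = (1 - t / real n) ^ (n - 1)"
    using eventually_gt_at_top[of "nat \<lceil>\<bar>t\<bar>\<rceil>"]
  proof eventually_elim
    case (elim n)
    then have "\<bar>t\<bar> < real n" by linarith
    then have "1 - t / real n \<noteq> 0" by (auto simp: field_simps)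
    moreover have "(1 - t / real n) ^ n = (1 - t / real n) * (1 - t / real n) ^ (n - 1)"
      using elim by (simp add: power_eq_if)
    ultimately show ?case by simp
  qed
  ultimately show ?thesis by (simp add: Lim_transform_eventually)
qed

text \<open>The density of the minimum of \<open>n\<close> independent uniform variables. As large
  samples come from small \<open>u\<close>, \<open>quantile\<close> of this minimum is distributed
  as the maximum of \<open>n\<close> samples.\<close>

definition min_density :: "nat \<Rightarrow> real \<Rightarrow> real" where
  "min_density n u = indicator {0<..<1} u * (real n * (1 - u) ^ (n - 1))"

text \<open>The minimum lives on the scale \<open>1 / n\<close>: the substitution
  \<open>u = t / n\<close> cancels the factor \<open>n\<close> of the density and shifts the
  argument of \<open>\<Psi>\<close> by \<open>ln n / \<theta>\<close>.\<close>

lemma integral_max_scaled: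
  assumes "1 \<le> n"
  shows "(\<integral>u. min_density n u * quantile u \<partial>lborel)
      = (\<integral>t. indicator {0<..<real n} t * ((1 - t / real n) ^ (n - 1) * \<Psi> (ln (real n) / \<theta> - ln t / \<theta>)) \<partial>lborel)"
proof -
  have "(\<integral>u. min_density n u * quantile u \<partial>lborel)
      = \<bar>1 / real n\<bar> *\<^sub>R (\<integral>t. min_density n (0 + 1 / real n * t) * quantile (0 + 1 / real n * t) \<partial>lborel)"
    using assms by (intro lborel_integral_real_affine) simp
  also have "\<dots> = (\<integral>t. 1 / real n * (min_density n (t / real n) * quantile (t / real n)) \<partial>lborel)"
    by (subst integral_mult_right_zero) simp
  also have "\<dots> = (\<integral>t. indicator {0<..<real n} t *
      ((1 - t / real n) ^ (n - 1) * \<Psi> (ln (real n) / \<theta> - ln t / \<theta>)) \<partial>lborel)"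
    using assms
    by (intro Bochner_Integration.integral_cong refl)
      (auto simp: min_density_def quantile_scale zero_less_divide_iff divide_less_eq split: split_indicator)
  finally show ?thesis .
qed

text \<open>Pointwise the scaled integrand tends to
  \<open>exp (- t) * t powr (- (c / \<theta>))\<close>, whose integral is the Gamma value. For the
  majorant, \<open>psi_growth\<close> bounds the ratio of \<open>\<psi>\<close> when
  \<open>t \<le> 1\<close>, and monotonicity bounds it by 1 when \<open>t > 1\<close>.\<close>

lemma integral_max_asymp:
  "(\<lambda>n. (\<integral>u. min_density n u * quantile u \<partial>lborel) / \<psi> (ln (real n) / \<theta>)) \<longlonglongrightarrow> Gamma (1 - c / \<theta>)"
proof -
  obtain d Y where d: "0 < d" "d < \<theta>" "0 < Y"
    and Y: "\<And>y z. Y \<le> y \<Longrightarrow> y \<le> z \<Longrightarrow> \<psi> z \<le> \<psi> y * exp (d * (z - y))"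
    by (rule psi_growth) blast
  define b where "b n = ln (real n) / \<theta>" for n :: nat
  have b_top: "filterlim b at_top sequentially"
    unfolding b_def using theta_pos
    by real_asymp
  define s where "s n t = indicator {0<..<real n} t *
      ((1 - t / real n) ^ (n - 1) * (\<Psi> (b n - ln t / \<theta>) / \<psi> (b n)))" for n and t :: real
  \<comment> \<open>The summand with exponent \<open>- 0\<close> is just \<open>exp (- t)\<close>,
    written so that the Gamma integral applies with parameter 0.\<close>
  define w where "w t = exp 1 * (indicator {0<..} t * (t powr (- 0) * exp (- t))
      + indicator {0<..} t * (t powr (- (d / \<theta>)) * exp (- t)))" for t :: real
  define g where "g t = indicator {0<..} t * (t powr (- (c / \<theta>)) * exp (- t))" for t :: real
  have frac: "d / \<theta> < 1" "c / \<theta> < 1" using d theta_pos c_less by auto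
  \<comment> \<open>Dominated convergence for sequences wants the majorant at every index, so the
    sequence is started where \<open>b n\<close> has passed \<open>Y\<close>; the offset is removed
    at the end.\<close>
  obtain N where N: "\<And>n. n \<ge> N \<Longrightarrow> Y \<le> b n" "N \<ge> 1"
  proof -
    have "\<forall>\<^sub>F n in sequentially. Y \<le> b n" using b_top by (simp add: filterlim_at_top)
    then obtain N where "\<forall>n\<ge>N. Y \<le> b n" by (auto simp: eventually_sequentially)
    then show ?thesis by (intro that[of "max N 1"]) auto
  qed
  have "(\<lambda>n. integral\<^sup>L lborel (s (n + N))) \<longlonglongrightarrow> integral\<^sup>L lborel g"
  proof (rule integral_dominated_convergence)
    show "g \<in> borel_measurable lborel" unfolding g_def by measurable
    show "s (n + N) \<in> borel_measurable lborel" for n unfolding s_def by measurable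
    show "integrable lborel w"
      unfolding w_def using has_bochner_integral_Gamma[OF frac(1)] has_bochner_integral_Gamma[of 0]
      by (intro integrable_mult_right Bochner_Integration.integrable_add) (simp_all add: has_bochner_integral_iff)
    show "AE t in lborel. norm (s (n + N) t) \<le> w t" for n
    proof (rule AE_I2)
      fix t :: real
      define m where "m = n + N"
      have m: "Y \<le> b m" "1 \<le> m" using N by (auto simp: m_def)
      have pos: "0 < \<psi> (b m)" using m d by (intro psi_pos) simp
      show "norm (s (n + N) t) \<le> w t"
      proof (cases "0 < t \<and> t < real m")
        case True
        have "ln t \<le> ln (real m)" using True by simp
        then have nonneg: "0 \<le> b m - ln t / \<theta>"
          using theta_pos by (simp add: b_def diff_divide_distrib[symmetric])
        then have eq: "\<Psi> (b m - ln t / \<theta>) = \<psi> (b m - ln t / \<theta>)" by (simp add: \<Psi>_def)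
        have ratio: "\<psi> (b m - ln t / \<theta>) / \<psi> (b m) \<le> 1 + t powr (- (d / \<theta>))"
        proof (cases "t \<le> 1")
          case t: True
          then have "ln t / \<theta> \<le> 0" using theta_pos True by (simp add: divide_le_0_iff)
          then have "\<psi> (b m - ln t / \<theta>) \<le> \<psi> (b m) * exp (d * (- ln t / \<theta>))"
            using Y[OF m(1), of "b m - ln t / \<theta>"] by simp
          also have "exp (d * (- ln t / \<theta>)) = t powr (- (d / \<theta>))"
            using True by (simp add: powr_def)
          finally have "\<psi> (b m - ln t / \<theta>) / \<psi> (b m) \<le> t powr (- (d / \<theta>))"
            using pos by (simp add: pos_divide_le_eq mult.commute)
          then show ?thesis by simp
        next
          case False
          then have "0 \<le> ln t / \<theta>" using theta_pos by simp
          then have "\<psi> (b m - ln t / \<theta>) \<le> \<psi> (b m)"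
            using nonneg by (simp add: psi_le_psi_iff)
          then have "\<psi> (b m - ln t / \<theta>) / \<psi> (b m) \<le> 1" using pos by simp
          then show ?thesis by (simp add: add_increasing2)
        qed
        have "0 \<le> 1 - t / real m" using True by simp
        then have "norm (s m t) = (1 - t / real m) ^ (m - 1) * (\<psi> (b m - ln t / \<theta>) / \<psi> (b m))"
          using True pos nonneg by (simp add: s_def eq psi_nonneg)
        also have "\<dots> \<le> (exp 1 * exp (- t)) * (1 + t powr (- (d / \<theta>)))"
          using True m pos nonneg \<open>0 \<le> 1 - t / real m\<close>
          by (intro mult_mono ratio one_minus_power_le) (auto simp: psi_nonneg)
        also have "\<dots> = w t" using True by (simp add: w_def algebra_simps)
        finally show ?thesis by (simp add: m_def)
      next
        case False
        then have "s m t = 0" by (simp add: s_def)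
        moreover have "0 \<le> w t" by (simp add: w_def)
        ultimately show ?thesis by (simp add: m_def)
      qed
    qed
    show "AE t in lborel. (\<lambda>n. s (n + N) t) \<longlonglongrightarrow> g t"
    proof (rule AE_I2, rule LIMSEQ_ignore_initial_segment)
      fix t :: real
      show "(\<lambda>n. s n t) \<longlonglongrightarrow> g t"
      proof (cases "0 < t")
        case True
        have "(\<lambda>n. (1 - t / real n) ^ (n - 1) * (\<psi> (b n - ln t / \<theta>) / \<psi> (b n)))
            \<longlonglongrightarrow> exp (- t) * exp (c * (- ln t / \<theta>))"
          by (intro tendsto_mult one_minus_power_tendsto psi_ratio_tendsto b_top) simp
        moreover have "exp (- t) * exp (c * (- ln t / \<theta>)) = g t"
          using True by (simp add: g_def powr_def)
        moreover have "\<forall>\<^sub>F n in sequentially.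
            (1 - t / real n) ^ (n - 1) * (\<psi> (b n - ln t / \<theta>) / \<psi> (b n)) = s n t"
          using eventually_gt_at_top[of "nat \<lceil>t\<rceil>"]
        proof eventually_elim
          case (elim n)
          then have "t < real n" by linarith
          then have "0 \<le> b n - ln t / \<theta>"
            using theta_pos True by (simp add: b_def diff_divide_distrib[symmetric])
          then show ?case using True \<open>t < real n\<close> by (simp add: s_def \<Psi>_def)
        qed
        ultimately show ?thesis by (simp add: Lim_transform_eventually)
      qed (simp add: s_def g_def)
    qed
  qed
  also have "integral\<^sup>L lborel g = Gamma (1 - c / \<theta>)"
    using has_bochner_integral_Gamma[OF frac(2)] by (simp add: has_bochner_integral_iff g_def[abs_def])
  finally have "(\<lambda>n. integral\<^sup>L lborel (s n)) \<longlonglongrightarrow> Gamma (1 - c / \<theta>)"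
    by (rule LIMSEQ_offset)
  moreover have "\<forall>\<^sub>F n in sequentially. integral\<^sup>L lborel (s n)
      = (\<integral>u. min_density n u * quantile u \<partial>lborel) / \<psi> (ln (real n) / \<theta>)"
    using eventually_ge_at_top[of 1]
  proof eventually_elim
    case (elim n)
    have "s n = (\<lambda>t. indicator {0<..<real n} t * ((1 - t / real n) ^ (n - 1) *
        \<Psi> (ln (real n) / \<theta> - ln t / \<theta>)) / \<psi> (ln (real n) / \<theta>))"
      by (auto simp: s_def b_def)
    then show ?case using integral_max_scaled[OF elim] by simp
  qed
  ultimately show ?thesis by (rule Lim_transform_eventually)
qed


subsection \<open>The value recursion\<close>

text \<open>The value of the problem with \<open>k\<close> observations still to come; the initial 0
  is the reward for never accepting a sample.\<close>

primrec stop_value :: "nat \<Rightarrow> real" where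
  "stop_value 0 = 0"
| "stop_value (Suc k) = stop_value k + excess (stop_value k)"

lemma excess_nonneg: "0 \<le> excess w"
  unfolding excess_def by (intro Bochner_Integration.integral_nonneg) auto

lemma stop_value_Suc:
  "stop_value (Suc k) = (\<integral>u. indicator {0<..<1} u * max (quantile u) (stop_value k) \<partial>lborel)"
  by (simp add: integral_max_quantile)

text \<open>Each further observation adds at most one mean excess over \<open>w\<close>. The
  induction step uses \<open>max x (w + h) \<le> h + max x w\<close> for
  \<open>h \<ge> 0\<close>.\<close>

lemma stop_value_le: "0 \<le> w \<Longrightarrow> stop_value k \<le> w + real k * excess w"
proof (induction k)
  case (Suc k)
  define h where "h = real k * excess w"
  have "h \<ge> 0" by (simp add: h_def excess_nonneg)
  have "stop_value (Suc k) \<le> (\<integral>u. indicator {0<..<1} u * h + indicator {0<..<1} u * max (quantile u) w \<partial>lborel)"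
    unfolding stop_value_Suc
  proof (intro integral_mono integrable_max_quantile Bochner_Integration.integrable_add)
    fix u :: real
    show "indicator {0<..<1} u * max (quantile u) (stop_value k)
        \<le> indicator {0<..<1} u * h + indicator {0<..<1} u * max (quantile u) w"
      using Suc \<open>h \<ge> 0\<close> by (auto simp: h_def split: split_indicator)
  qed simp
  also have "\<dots> = h + (w + excess w)"
    by (subst Bochner_Integration.integral_add[OF _ integrable_max_quantile])
      (simp_all add: integral_max_quantile)
  finally show ?case by (simp add: h_def algebra_simps)
qed simp

text \<open>The bound counts a reward of \<open>\<psi> y\<close> whenever one of \<open>k\<close>
  samples reaches the static threshold \<open>\<psi> y\<close>. A single sample does so with
  probability \<open>exp (- \<theta> * y)\<close>.\<close>

lemma stop_value_ge:
  assumes "0 \<le> y"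
  shows "\<psi> y * (1 - (1 - exp (- \<theta> * y)) ^ k) \<le> stop_value k"
proof (induction k)
  case (Suc k)
  define p where "p = exp (- \<theta> * y)"
  have p: "0 < p" "p \<le> 1" using assms theta_pos by (auto simp: p_def)
  \<comment> \<open>The mixture is realised on the unit interval: \<open>\<psi> y\<close> where
    \<open>u \<le> p\<close>, that is where the sample reaches the threshold, and the continuation
    value elsewhere.\<close>
  have "p * \<psi> y + (1 - p) * stop_value k
      = (\<integral>u. indicator {0..p} u * \<psi> y + indicator {p..1} u * stop_value k \<partial>lborel)"
    using p by (subst Bochner_Integration.integral_add) simp_all
  also have "\<dots> = (\<integral>u. indicator {0<..<1} u * (indicator {0..p} u * \<psi> y + indicator {p<..<1} u * stop_value k) \<partial>lborel)"
  proof (rule integral_cong_AE)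
    have "AE u in lborel. u \<noteq> (0::real) \<and> u \<noteq> 1 \<and> u \<noteq> p"
      by (intro AE_conjI AE_lborel_singleton)
    then show "AE u in lborel. indicator {0..p} u * \<psi> y + indicator {p..1} u * stop_value k
        = indicator {0<..<1} u * (indicator {0..p} u * \<psi> y + indicator {p<..<1} u * stop_value k)"
      by eventually_elim (use p in \<open>auto split: split_indicator\<close>)
  qed measurable
  also have "\<dots> \<le> stop_value (Suc k)"
    unfolding stop_value_Suc
  proof (intro integral_mono integrable_max_quantile integrable_quantile_of_bound)
    fix u :: real
    show "\<bar>indicator {0..p} u * \<psi> y + indicator {p<..<1} u * stop_value k\<bar>
        \<le> quantile u + (\<bar>\<psi> y\<bar> + \<bar>stop_value k\<bar>)"
      using quantile_nonneg[of u] by (auto split: split_indicator)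
    have "\<psi> y \<le> quantile u" if "0 < u" "u < 1" "u \<le> p"
    \<comment> \<open>A smaller quantile would force \<open>p \<le> u\<close>, hence
      \<open>u = p\<close>, but the quantile at \<open>p\<close> is exactly
      \<open>\<psi> y\<close>.\<close>
    proof (rule ccontr)
      assume "\<not> \<psi> y \<le> quantile u"
      moreover from this have "p \<le> u"
        using quantile_le_iff[of u "\<psi> y"] that assms by (simp add: psi_ge phi_psi p_def)
      ultimately have "quantile p < \<psi> y" using that by simp
      moreover have "quantile p = \<psi> y"
        using p theta_pos assms by (simp add: quantile_eq p_def)
      ultimately show False by simp
    qed
    then show "indicator {0<..<1} u * (indicator {0..p} u * \<psi> y + indicator {p<..<1} u * stop_value k)
        \<le> indicator {0<..<1} u * max (quantile u) (stop_value k)"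
      by (auto split: split_indicator)
  qed measurable
  finally have *: "p * \<psi> y + (1 - p) * stop_value k \<le> stop_value (Suc k)" .
  have "\<psi> y * (1 - (1 - p) ^ Suc k) = p * \<psi> y + (1 - p) * (\<psi> y * (1 - (1 - p) ^ k))"
    by (simp add: algebra_simps)
  also have "\<dots> \<le> p * \<psi> y + (1 - p) * stop_value k"
    using Suc p by (intro add_left_mono mult_left_mono) (auto simp: p_def)
  also note *
  finally show ?case by (simp add: p_def)
qed simp

lemma psi_at_top: "filterlim \<psi> at_top at_top"
  unfolding filterlim_at_top
proof
  fix Z :: real
  show "\<forall>\<^sub>F y in at_top. Z \<le> \<psi> y"
    using eventually_ge_at_top[of "\<phi> (max Z x0)"]
  proof eventually_elim
    case (elim y)
    then have "\<psi> (\<phi> (max Z x0)) \<le> \<psi> y"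
      using phi_nonneg[of "max Z x0"] by (subst psi_le_psi_iff) auto
    then show ?case by (simp add: psi_phi)
  qed
qed

lemma phi_at_top: "filterlim \<phi> at_top at_top"
  unfolding filterlim_at_top
proof
  fix Z :: real
  show "\<forall>\<^sub>F x in at_top. Z \<le> \<phi> x"
    using eventually_ge_at_top[of "\<psi> (max Z 0)"]
  proof eventually_elim
    case (elim x)
    then have "max Z 0 \<le> \<phi> x"
      using psi_le_iff[of "max Z 0" x] psi_ge[of "max Z 0"] by auto
    then show ?case by simp
  qed
qed

text \<open>For fixed \<open>y\<close> the lower bound of \<open>stop_value_ge\<close> tends to
  \<open>\<psi> y\<close> as \<open>k\<close> grows, and \<open>\<psi> y\<close> can be made
  arbitrarily large; the factor 2 leaves room for a strict inequality.\<close>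

lemma stop_value_at_top: "filterlim stop_value at_top sequentially"
proof (rule filterlim_at_top_gt[where c = 0, THEN iffD2], intro allI impI)
  fix Z :: real assume "Z > 0"
  have "\<forall>\<^sub>F y in at_top. 2 * Z \<le> \<psi> y" "\<forall>\<^sub>F y in at_top. (0::real) \<le> y"
    using psi_at_top by (auto simp: filterlim_at_top eventually_ge_at_top)
  then have "\<forall>\<^sub>F y in at_top. 2 * Z \<le> \<psi> y \<and> 0 \<le> y" by eventually_elim simp
  then obtain y where y: "2 * Z \<le> \<psi> y" "0 \<le> y"
    by (auto dest!: eventually_happens)
  have "(\<lambda>k. \<psi> y * (1 - (1 - exp (- \<theta> * y)) ^ k)) \<longlonglongrightarrow> \<psi> y * (1 - 0)"
    using y theta_pos by (intro tendsto_intros LIMSEQ_power_zero) auto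
  then have "\<forall>\<^sub>F k in sequentially. Z < \<psi> y * (1 - (1 - exp (- \<theta> * y)) ^ k)"
    using y \<open>Z > 0\<close> by (intro order_tendstoD(1)) auto
  then show "\<forall>\<^sub>F k in sequentially. Z \<le> stop_value k"
  proof eventually_elim
    case (elim k)
    then show ?case using stop_value_ge[OF y(2), of k] by linarith
  qed
qed

section \<open>Asymptotics of the value\<close>

lemma ln_over_theta_at_top: "filterlim (\<lambda>n. ln (real n) / \<theta>) at_top sequentially"
  using theta_pos by real_asymp

text \<open>Upper bound: at the threshold \<open>\<psi> (ln n / \<theta>)\<close> the
  \<open>n\<close> mean excesses add up to a negligible multiple of the threshold, because
  \<open>c / (\<theta> - c) = 0\<close>. Lower bound: the threshold
  \<open>\<psi> (ln (n / K) / \<theta>)\<close> is asymptotically the same one, and some sample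
  reaches it with probability close to \<open>1 - exp (- K)\<close>.\<close>

lemma stop_value_asymp_zero:
  assumes "c = 0"
  shows "(\<lambda>n. stop_value n / \<psi> (ln (real n) / \<theta>)) \<longlonglongrightarrow> 1"
proof (rule order_tendstoI)
  note b_top = ln_over_theta_at_top
  have b: "\<forall>\<^sub>F n in sequentially. 0 < ln (real n) / \<theta>"
    using b_top by (simp add: filterlim_at_top_dense)
  fix a :: real
  {
    assume "1 < a"
    have "(\<lambda>n. 1 + excess (\<psi> (ln (real n) / \<theta>)) * exp (\<theta> * (ln (real n) / \<theta>)) / \<psi> (ln (real n) / \<theta>))
        \<longlonglongrightarrow> 1 + c / (\<theta> - c)"
      by (intro tendsto_intros filterlim_compose[OF excess_asymp b_top])
    then have "\<forall>\<^sub>F n in sequentially.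
        1 + excess (\<psi> (ln (real n) / \<theta>)) * exp (\<theta> * (ln (real n) / \<theta>)) / \<psi> (ln (real n) / \<theta>) < a"
      using \<open>1 < a\<close> assms by (intro order_tendstoD(2)) auto
    then show "\<forall>\<^sub>F n in sequentially. stop_value n / \<psi> (ln (real n) / \<theta>) < a"
      using b eventually_gt_at_top[of 0]
    proof eventually_elim
      case (elim n)
      define y where "y = ln (real n) / \<theta>"
      have "0 < \<psi> y" using elim by (intro psi_pos) (simp add: y_def)
      moreover have "real n = exp (\<theta> * y)" using elim theta_pos by (simp add: y_def)
      ultimately have "stop_value n / \<psi> y \<le> 1 + excess (\<psi> y) * exp (\<theta> * y) / \<psi> y"
        using stop_value_le[of "\<psi> y" n] by (simp add: field_simps)
      then show ?case using elim unfolding y_def by linarith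
    qed
  }
  {
    assume "a < 1"
    \<comment> \<open>\<open>K\<close> is the mean number of samples reaching the lowered threshold;
      it is fixed so large that the success probability exceeds \<open>a\<close>.\<close>
    have "((\<lambda>K. 1 - exp (- K)) \<longlongrightarrow> (1::real)) at_top" by real_asymp
    then have "\<forall>\<^sub>F K in at_top. a < 1 - exp (- K :: real)"
      using \<open>a < 1\<close> by (rule order_tendstoD(1))
    moreover have "\<forall>\<^sub>F K in at_top. (0::real) < K" by (rule eventually_gt_at_top)
    ultimately have "\<forall>\<^sub>F K in at_top. a < 1 - exp (- K :: real) \<and> 0 < K" by eventually_elim simp
    then obtain K :: real where K: "a < 1 - exp (- K)" "0 < K"
      by (auto dest!: eventually_happens)
    have "(\<lambda>n. \<psi> (ln (real n) / \<theta> - ln K / \<theta>) / \<psi> (ln (real n) / \<theta>) * (1 - (1 + (- K) / real n) ^ n))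
        \<longlonglongrightarrow> exp (c * (- ln K / \<theta>)) * (1 - exp (- K))"
      by (intro tendsto_mult psi_ratio_tendsto b_top tendsto_diff tendsto_const tendsto_exp_limit_sequentially) simp
    then have "\<forall>\<^sub>F n in sequentially.
        a < \<psi> (ln (real n) / \<theta> - ln K / \<theta>) / \<psi> (ln (real n) / \<theta>) * (1 - (1 + (- K) / real n) ^ n)"
      using K assms by (intro order_tendstoD(1)) auto
    then show "\<forall>\<^sub>F n in sequentially. a < stop_value n / \<psi> (ln (real n) / \<theta>)"
      using b eventually_gt_at_top[of "nat \<lceil>K\<rceil>"]
    proof eventually_elim
      case (elim n)
      then have n: "K < real n" by linarith
      define y where "y = ln (real n) / \<theta>"
      define z where "z = ln (real n) / \<theta> - ln K / \<theta>"
      have "0 < \<psi> y" using elim by (intro psi_pos) (simp add: y_def)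
      have "0 \<le> z"
        using n K theta_pos by (simp add: z_def diff_divide_distrib[symmetric])
      moreover have "exp (- \<theta> * z) = K / real n"
      proof -
        have "- \<theta> * z = ln K - ln (real n)" using theta_pos by (simp add: z_def field_simps)
        then show ?thesis using n K by (simp add: exp_diff)
      qed
      ultimately have "\<psi> z * (1 - (1 - K / real n) ^ n) \<le> stop_value n"
        using stop_value_ge[of z n] by simp
      then have "\<psi> z / \<psi> y * (1 - (1 - K / real n) ^ n) \<le> stop_value n / \<psi> y"
        using \<open>0 < \<psi> y\<close> by (simp add: divide_right_mono)
      then show ?case using elim(1) unfolding y_def z_def by simp
    qed
  }
qed

text \<open>
  In the scale \<open>exp (\<theta> * \<phi> v) = 1 / P(X > v)\<close> the value recursion has asymptotically constant
  increments.
\<close>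

lemma stop_value_asymp_pos:
  assumes "0 < c"
  shows "(\<lambda>n. stop_value n / \<psi> (ln (real n) / \<theta>)) \<longlonglongrightarrow> (\<theta> / (\<theta> - c)) powr (c / \<theta>)"
proof -
  define y where "y k = \<phi> (stop_value k)" for k
  define Q where "Q k = exp (\<theta> * y k)" for k
  \<comment> \<open>\<open>R k / Q k\<close> is the relative increment of the value, and
    \<open>R\<close> converges by \<open>excess_asymp\<close>.\<close>
  define R where "R k = excess (stop_value k) * Q k / stop_value k" for k
  define \<delta> where "\<delta> k = y (Suc k) - y k" for k
  have y_top: "filterlim y at_top sequentially"
    unfolding y_def by (rule filterlim_compose[OF phi_at_top stop_value_at_top])
  have Q_top: "filterlim Q at_top sequentially"
    unfolding Q_def using theta_pos
    by (intro filterlim_compose[OF exp_at_top] filterlim_tendsto_pos_mult_at_top[OF tendsto_const _ y_top])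
  have ev_ge: "\<forall>\<^sub>F k in sequentially. x0 \<le> stop_value k" "\<forall>\<^sub>F k in sequentially. 0 < stop_value k"
    using stop_value_at_top by (simp add: filterlim_at_top) (use stop_value_at_top in \<open>simp add: filterlim_at_top_dense\<close>)
  then have ev_psi: "\<forall>\<^sub>F k in sequentially. \<psi> (y k) = stop_value k"
    by (auto elim!: eventually_mono simp: y_def psi_phi)
  have R_lim: "R \<longlonglongrightarrow> c / (\<theta> - c)"
  proof (rule Lim_transform_eventually[OF filterlim_compose[OF excess_asymp y_top]])
    show "\<forall>\<^sub>F k in sequentially. excess (\<psi> (y k)) * exp (\<theta> * y k) / \<psi> (y k) = R k"
      using ev_psi by eventually_elim (simp add: R_def Q_def)
  qed
  have lim_pos: "0 < c / (\<theta> - c)" using assms c_less by simp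
  have R_pos: "\<forall>\<^sub>F k in sequentially. 0 < R k"
    using order_tendstoD(1)[OF R_lim lim_pos] .
  have Q_pos: "0 < Q k" for k by (simp add: Q_def)
  have step: "\<forall>\<^sub>F k in sequentially. stop_value (Suc k) = stop_value k * (1 + R k / Q k)"
    using ev_ge(2) by eventually_elim (simp add: R_def Q_def field_simps)
  have delta_pos: "\<forall>\<^sub>F k in sequentially. 0 < \<delta> k"
    using step R_pos ev_ge
  proof eventually_elim
    case (elim k)
    have "stop_value k < stop_value (Suc k)"
      unfolding elim(1) using elim Q_pos[of k] by simp
    then show ?case
      using elim(3) phi_le_iff[of "stop_value (Suc k)" "stop_value k"] by (simp add: \<delta>_def y_def not_le[symmetric])
  qed
  define L where "L k = ln (stop_value (Suc k)) - ln (stop_value k)" for k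
  \<comment> \<open>The bound of \<open>log_increment\<close> is proportional to the step length, so
    it survives division by \<open>\<delta> k\<close> although \<open>\<delta> k\<close> tends to
    0.\<close>
  have slope: "(\<lambda>k. L k / \<delta> k) \<longlonglongrightarrow> c"
  proof (rule tendstoI)
    fix e :: real assume "e > 0"
    obtain Y where Y: "\<And>y z. y \<ge> Y \<Longrightarrow> z \<ge> Y \<Longrightarrow>
        \<bar>ln (\<psi> z) - ln (\<psi> y) - c * (z - y)\<bar> \<le> e / 2 * \<bar>z - y\<bar>"
      using log_increment[of "e / 2"] \<open>e > 0\<close> by auto
    have "\<forall>\<^sub>F k in sequentially. Y \<le> y k" using y_top by (simp add: filterlim_at_top)
    moreover have "\<forall>\<^sub>F k in sequentially. \<psi> (y (Suc k)) = stop_value (Suc k)"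
      using ev_psi by (rule iffD2[OF eventually_sequentially_Suc])
    ultimately show "\<forall>\<^sub>F k in sequentially. dist (L k / \<delta> k) c < e"
      using ev_psi delta_pos
    proof eventually_elim
      case (elim k)
      have "\<bar>L k - c * \<delta> k\<bar> \<le> e / 2 * \<bar>\<delta> k\<bar>"
        using Y[of "y k" "y (Suc k)"] elim by (simp add: L_def \<delta>_def)
      then have "\<bar>L k - c * \<delta> k\<bar> / \<delta> k \<le> e / 2"
        using elim by (simp add: pos_divide_le_eq)
      moreover have "dist (L k / \<delta> k) c = \<bar>L k - c * \<delta> k\<bar> / \<delta> k"
      proof -
        have "L k / \<delta> k - c = (L k - c * \<delta> k) / \<delta> k" using elim by (simp add: diff_divide_distrib)
        then show ?thesis using elim by (simp only: dist_real_def abs_div_pos)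
      qed
      ultimately have "dist (L k / \<delta> k) c \<le> e / 2" by simp
      also have "\<dots> < e" using \<open>e > 0\<close> by simp
      finally show ?case .
    qed
  qed
  have RQ: "(\<lambda>k. R k / Q k) \<longlonglongrightarrow> 0"
    by (rule real_tendsto_divide_at_top[OF R_lim Q_top])
  \<comment> \<open>Linearising the logarithm replaces the relative increment
    \<open>R k / Q k\<close> by the logarithmic increment \<open>L k\<close>.\<close>
  have "((\<lambda>z::real. ln (1 + z) / z) \<longlongrightarrow> 1) (at 0)" by real_asymp
  moreover have "filterlim (\<lambda>k. R k / Q k) (at 0) sequentially"
    using RQ R_pos by (auto simp: filterlim_at Q_def elim!: eventually_mono)
  ultimately have "(\<lambda>k. R k * (ln (1 + R k / Q k) / (R k / Q k))) \<longlonglongrightarrow> c / (\<theta> - c) * 1"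
    by (intro tendsto_mult R_lim) (rule filterlim_compose)
  moreover have "\<forall>\<^sub>F k in sequentially. R k * (ln (1 + R k / Q k) / (R k / Q k)) = Q k * L k"
    using step R_pos ev_ge(2)
  proof eventually_elim
    case (elim k)
    have "L k = ln (1 + R k / Q k)"
    proof -
      have "0 < 1 + R k / Q k" using elim(2) Q_pos[of k] by (simp add: add_pos_pos)
      then show ?thesis unfolding L_def elim(1) using elim(3) by (simp add: ln_mult)
    qed
    then show ?case using elim by (simp add: Q_def)
  qed
  ultimately have QL: "(\<lambda>k. Q k * L k) \<longlonglongrightarrow> c / (\<theta> - c)"
    by (simp add: Lim_transform_eventually)
  \<comment> \<open>Dividing the logarithmic increment by its slope recovers the increment in the
    coordinate \<open>y\<close>; \<open>c > 0\<close> keeps the limit of the divisor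
    nonzero.\<close>
  have "(\<lambda>k. (Q k * L k) / (L k / \<delta> k)) \<longlonglongrightarrow> c / (\<theta> - c) / c"
    using assms by (intro tendsto_divide QL slope) auto
  moreover have "\<forall>\<^sub>F k in sequentially. (Q k * L k) / (L k / \<delta> k) = Q k * \<delta> k"
    using order_tendstoD(1)[OF slope assms] by eventually_elim auto
  ultimately have Qd: "(\<lambda>k. Q k * \<delta> k) \<longlonglongrightarrow> 1 / (\<theta> - c)"
    using assms by (simp add: Lim_transform_eventually)
  have "(\<lambda>k. Q k * \<delta> k / Q k) \<longlonglongrightarrow> 0"
    by (rule real_tendsto_divide_at_top[OF Qd Q_top])
  then have d0: "\<delta> \<longlonglongrightarrow> 0" by (simp add: Q_def)
  \<comment> \<open>Since \<open>Q (Suc k) = Q k * exp (\<theta> * \<delta> k)\<close> and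
    \<open>\<delta>\<close> tends to 0, the increment of \<open>Q\<close> behaves like
    \<open>\<theta> * Q k * \<delta> k\<close>.\<close>
  have "((\<lambda>z::real. (exp (\<theta> * z) - 1) / z) \<longlongrightarrow> \<theta>) (at 0)" using theta_pos by real_asymp
  moreover have "filterlim \<delta> (at 0) sequentially"
    using d0 delta_pos by (auto simp: filterlim_at elim!: eventually_mono)
  ultimately have "(\<lambda>k. (Q k * \<delta> k) * ((exp (\<theta> * \<delta> k) - 1) / \<delta> k)) \<longlonglongrightarrow> 1 / (\<theta> - c) * \<theta>"
    by (intro tendsto_mult Qd) (rule filterlim_compose)
  moreover have "\<forall>\<^sub>F k in sequentially. (Q k * \<delta> k) * ((exp (\<theta> * \<delta> k) - 1) / \<delta> k) = Q (Suc k) - Q k"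
    using delta_pos
  proof eventually_elim
    case (elim k)
    have "Q (Suc k) = Q k * exp (\<theta> * \<delta> k)"
      by (simp add: Q_def \<delta>_def exp_add[symmetric] algebra_simps)
    moreover have "(Q k * \<delta> k) * ((exp (\<theta> * \<delta> k) - 1) / \<delta> k) = Q k * (exp (\<theta> * \<delta> k) - 1)"
      using elim by simp
    ultimately show ?case by (simp add: right_diff_distrib)
  qed
  ultimately have "(\<lambda>k. Q (Suc k) - Q k) \<longlonglongrightarrow> \<theta> / (\<theta> - c)"
    by (simp add: Lim_transform_eventually)
  then have Qn: "(\<lambda>n. Q n / real n) \<longlonglongrightarrow> \<theta> / (\<theta> - c)"
    by (rule LIMSEQ_div_of_increments)
  have pos: "0 < \<theta> / (\<theta> - c)" using theta_pos c_less by simp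
  \<comment> \<open>Taking logarithms shows that \<open>y n\<close> is
    \<open>ln n / \<theta>\<close> plus a convergent shift, the situation of
    \<open>psi_ratio_tendsto\<close>.\<close>
  have "(\<lambda>n. ln (Q n / real n) / \<theta>) \<longlonglongrightarrow> ln (\<theta> / (\<theta> - c)) / \<theta>"
    using pos theta_pos by (intro tendsto_divide tendsto_ln Qn tendsto_const) auto
  moreover have "\<forall>\<^sub>F n in sequentially. ln (Q n / real n) / \<theta> = y n - ln (real n) / \<theta>"
    using eventually_gt_at_top[of 0]
    by eventually_elim (use theta_pos in \<open>simp add: ln_div Q_def diff_divide_distrib\<close>)
  ultimately have "(\<lambda>n. y n - ln (real n) / \<theta>) \<longlonglongrightarrow> ln (\<theta> / (\<theta> - c)) / \<theta>"
    by (rule Lim_transform_eventually)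
  from psi_ratio_tendsto[OF ln_over_theta_at_top this]
  have "(\<lambda>n. \<psi> (y n) / \<psi> (ln (real n) / \<theta>)) \<longlonglongrightarrow> exp (c * (ln (\<theta> / (\<theta> - c)) / \<theta>))" .
  also have "exp (c * (ln (\<theta> / (\<theta> - c)) / \<theta>)) = (\<theta> / (\<theta> - c)) powr (c / \<theta>)"
    using theta_pos c_less by (simp add: powr_def)
  finally show ?thesis
    by (rule Lim_transform_eventually) (use ev_psi in \<open>auto elim!: eventually_mono\<close>)
qed

lemma stop_value_asymp:
  "(\<lambda>n. stop_value n / \<psi> (ln (real n) / \<theta>)) \<longlonglongrightarrow> (\<theta> / (\<theta> - c)) powr (c / \<theta>)"
proof (cases "c = 0")
  case True
  then show ?thesis using stop_value_asymp_zero theta_pos by simp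
next
  case False
  then show ?thesis using stop_value_asymp_pos c_nonneg by simp
qed

end


section \<open>Optimal stopping by backward induction\<close>

lemma space_natural_filtration [simp]: "space (natural_filtration M X t) = space M"
  unfolding natural_filtration_def by (rule space_measure_of) auto

text \<open>Brings the generators into the shape of a union over indices, as needed for grouping
  independent families.\<close>

lemma sets_natural_filtration:
  "sets (natural_filtration M X t) =
     sigma_sets (space M) (\<Union>s\<in>{1..t}. {X s -` A \<inter> space M | A. A \<in> sets borel})"
proof -
  have "{X s -` A \<inter> space M | s A. s \<in> {1..t} \<and> A \<in> sets borel} =
      (\<Union>s\<in>{1..t}. {X s -` A \<inter> space M | A. A \<in> sets borel})"
    by blast
  then show ?thesis
    unfolding natural_filtration_def by (subst sets_measure_of) auto
qed

lemma measurable_natural_filtration: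
  assumes "1 \<le> s" "s \<le> t"
  shows "X s \<in> borel_measurable (natural_filtration M X t)"
proof (rule measurableI)
  fix A :: "real set" assume "A \<in> sets borel"
  moreover have "s \<in> {1..t}" using assms by simp
  ultimately have "X s -` A \<inter> space M \<in> (\<Union>s\<in>{1..t}. {X s -` A \<inter> space M | A. A \<in> sets borel})"
    by blast
  then show "X s -` A \<inter> space (natural_filtration M X t) \<in> sets (natural_filtration M X t)"
    by (simp add: sets_natural_filtration sigma_sets.Basic)
qed simp

lemma sets_natural_filtration_subset:
  assumes "\<And>s. s \<in> {1..t} \<Longrightarrow> X s \<in> borel_measurable M"
  shows "sets (natural_filtration M X t) \<subseteq> sets M"
  unfolding sets_natural_filtration using assms
  by (intro sets.sigma_sets_subset) (auto intro: measurable_sets)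

text \<open>Grouping: the index sets \<open>{1..t}\<close> and \<open>{Suc t}\<close> are disjoint
  and the generators are closed under intersection, so the generated sigma-algebras are independent.
  The pair is encoded as a family over \<open>bool\<close>.\<close>

lemma (in prob_space) indep_set_natural_filtration:
  assumes indep: "indep_vars (\<lambda>_. borel) X {1..n}" and "t < n"
  shows "indep_set (sets (natural_filtration M X t))
           (sigma_sets (space M) {X (Suc t) -` B \<inter> space M | B. B \<in> sets borel})"
proof -
  let ?E = "\<lambda>i. {X i -` A \<inter> space M | A. A \<in> sets borel}"
  let ?I = "case_bool {1..t} {Suc t}"
  have "indep_sets (\<lambda>j. sigma_sets (space M) (\<Union>i\<in>?I j. ?E i)) UNIV"
  proof (rule indep_sets_collect_sigma)
    have "(\<Union>j. ?I j) \<subseteq> {1..n}"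
      using \<open>t < n\<close> by (auto split: bool.splits)
    then show "indep_sets ?E (\<Union>j. ?I j)"
      using indep unfolding indep_vars_def2 by (blast intro: indep_sets_mono_index)
    show "Int_stable (?E i)" for i
    proof (rule Int_stableI)
      fix a b assume "a \<in> ?E i" "b \<in> ?E i"
      then obtain A B where "A \<in> sets borel" "B \<in> sets borel"
        "a = X i -` A \<inter> space M" "b = X i -` B \<inter> space M" by blast
      then show "a \<inter> b \<in> ?E i" by (intro CollectI exI[of _ "A \<inter> B"]) auto
    qed
    show "disjoint_family_on ?I UNIV"
      by (auto simp: disjoint_family_on_def split: bool.splits)
  qed
  then show ?thesis
    unfolding indep_set_def sets_natural_filtration
    by (rule indep_sets_mono_sets) (auto split: bool.splits)
qed

text \<open>Takes the place of conditioning on the past: the indicator of an event of the first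
  \<open>t\<close> samples is independent of any Borel function of the next sample.\<close>

lemma (in prob_space) integral_indicator_natural_filtration:
  fixes f :: "real \<Rightarrow> real"
  assumes indep: "indep_vars (\<lambda>_. borel) X {1..n}" and "t < n"
    and A: "A \<in> sets (natural_filtration M X t)"
    and f: "f \<in> borel_measurable borel" and int: "integrable M (\<lambda>\<omega>. f (X (Suc t) \<omega>))"
  shows "(\<integral>\<omega>. indicator A \<omega> * f (X (Suc t) \<omega>) \<partial>M) = prob A * (\<integral>\<omega>. f (X (Suc t) \<omega>) \<partial>M)"
proof -
  have meas: "X s \<in> borel_measurable M" if "s \<in> {1..n}" for s
    using indep that by (auto simp: indep_vars_def2)
  have A_event: "A \<in> events"
    using A \<open>t < n\<close> sets_natural_filtration_subset[of t X M] meas by auto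
  have "indep_set (sigma_sets (space M) {(indicator A :: _ \<Rightarrow> real) -` B \<inter> space M | B. B \<in> sets borel})
     (sigma_sets (space M) {(\<lambda>\<omega>. f (X (Suc t) \<omega>)) -` B \<inter> space M | B. B \<in> sets borel})"
    using indep_set_natural_filtration[OF indep \<open>t < n\<close>] unfolding indep_set_def
  proof (rule indep_sets_mono_sets)
    fix b :: bool
    have 1: "{(indicator A :: _ \<Rightarrow> real) -` B \<inter> space M | B. B \<in> sets borel} \<subseteq> sets (natural_filtration M X t)"
    proof safe
      fix B :: "real set" assume "B \<in> sets borel"
      have "(indicator A :: _ \<Rightarrow> real) \<in> borel_measurable (natural_filtration M X t)"
        using A by simp
      from measurable_sets[OF this \<open>B \<in> sets borel\<close>]
      show "(indicator A :: _ \<Rightarrow> real) -` B \<inter> space M \<in> sets (natural_filtration M X t)"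
        by simp
    qed
    have 2: "{(\<lambda>\<omega>. f (X (Suc t) \<omega>)) -` B \<inter> space M | B. B \<in> sets borel}
       \<subseteq> {X (Suc t) -` B \<inter> space M | B. B \<in> sets borel}"
    proof safe
      fix B :: "real set" assume "B \<in> sets borel"
      then show "\<exists>C. (\<lambda>\<omega>. f (X (Suc t) \<omega>)) -` B \<inter> space M = X (Suc t) -` C \<inter> space M \<and> C \<in> sets borel"
        using measurable_sets[OF f, of B] by (intro exI[of _ "f -` B"]) auto
    qed
    show "case_bool (sigma_sets (space M) {(indicator A :: _ \<Rightarrow> real) -` B \<inter> space M | B. B \<in> sets borel})
        (sigma_sets (space M) {(\<lambda>\<omega>. f (X (Suc t) \<omega>)) -` B \<inter> space M | B. B \<in> sets borel}) b
       \<subseteq> case_bool (sets (natural_filtration M X t))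
           (sigma_sets (space M) {X (Suc t) -` B \<inter> space M | B. B \<in> sets borel}) b"
      using sets.sigma_sets_subset[OF 1] sigma_sets_mono'[OF 2] by (auto split: bool.splits)
  qed
  then have "indep_var borel (indicator A) borel (\<lambda>\<omega>. f (X (Suc t) \<omega>))"
    unfolding indep_var_eq using A_event f meas[of "Suc t"] \<open>t < n\<close> by auto
  then have "(\<integral>\<omega>. indicator A \<omega> * f (X (Suc t) \<omega>) \<partial>M)
      = (\<integral>\<omega>. indicator A \<omega> \<partial>M) * (\<integral>\<omega>. f (X (Suc t) \<omega>) \<partial>M)"
    using A_event int by (intro indep_var_lebesgue_integral) (auto simp: less_top[symmetric])
  then show ?thesis using A_event by simp
qed

text \<open>Read \<open>s\<close> as the stopping time and \<open>v k\<close> as the value with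
  \<open>k\<close> observations left. Observation \<open>t + 1\<close> changes the value from
  \<open>v (n - t)\<close> to the sample if it is taken and to \<open>v (n - Suc t)\<close>
  otherwise; after stopping nothing changes.\<close>

lemma reward_telescope:
  fixes v x :: "nat \<Rightarrow> real"
  assumes "1 \<le> s" "m \<le> n"
  shows "(\<Sum>t<m. of_bool (t < s) * ((if s = Suc t then x (Suc t) else v (n - Suc t)) - v (n - t)))
       = (if s \<le> m then x s else v (n - m)) - v n"
  using \<open>m \<le> n\<close>
proof (induction m)
  case 0
  then show ?case using \<open>1 \<le> s\<close> by simp
next
  case (Suc m)
  then show ?case by (cases "s = Suc m") auto
qed

section \<open>One-step gains of a policy\<close>

locale optimal_stopping = prob_space M for M :: "'a measure" +
  fixes X :: "nat \<Rightarrow> 'a \<Rightarrow> real" and n :: nat and v :: "nat \<Rightarrow> real"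
  assumes indep: "indep_vars (\<lambda>_. borel) X {1..n}"
    and integrable_X: "\<And>t. t \<in> {1..n} \<Longrightarrow> integrable M (X t)"
    and v_0: "v 0 = 0"
    and v_Suc: "\<And>k t. t \<in> {1..n} \<Longrightarrow> (\<integral>\<omega>. max (X t \<omega>) (v k) \<partial>M) = v (Suc k)"
begin

text \<open>The change of value caused by observation \<open>t + 1\<close> and the decision of
  \<open>\<sigma>\<close> about it.\<close>

definition gain :: "('a \<Rightarrow> nat) \<Rightarrow> nat \<Rightarrow> 'a \<Rightarrow> real" where
  "gain \<sigma> t \<omega> = of_bool (t < \<sigma> \<omega>) *
     ((if \<sigma> \<omega> = Suc t then X (Suc t) \<omega> else v (n - Suc t)) - v (n - t))"

text \<open>The same change when the better of stopping and continuing is credited at instant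
  \<open>t + 1\<close>.\<close>

definition max_gain :: "('a \<Rightarrow> nat) \<Rightarrow> nat \<Rightarrow> 'a \<Rightarrow> real" where
  "max_gain \<sigma> t \<omega> = of_bool (t < \<sigma> \<omega>) * (max (X (Suc t) \<omega>) (v (n - Suc t)) - v (n - t))"

lemma policy_event:
  assumes "policy M X n \<sigma>"
  shows "{\<omega> \<in> space M. t < \<sigma> \<omega>} \<in> sets (natural_filtration M X t)"
  using assms stopping_timeD2[of "natural_filtration M X" \<sigma> t]
  by (auto simp: policy_def pred_def)

text \<open>For \<open>t \<le> n\<close> the event is decided by measurable samples; for larger
  \<open>t\<close> it is empty because policies are bounded by \<open>n + 1\<close>.\<close>

lemma policy_event_sets:
  assumes "policy M X n \<sigma>"
  shows "{\<omega> \<in> space M. t < \<sigma> \<omega>} \<in> events"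
proof (cases "t \<le> n")
  case True
  then show ?thesis
    using policy_event[OF assms, of t] sets_natural_filtration_subset[of t X M] indep
    by (auto simp: indep_vars_def2)
next
  case False
  then have "\<not> t < \<sigma> \<omega>" if "\<omega> \<in> space M" for \<omega>
  proof -
    have "\<sigma> \<omega> \<in> {1..n + 1}" using assms that by (simp add: policy_def)
    then show ?thesis using False by simp
  qed
  then have "{\<omega> \<in> space M. t < \<sigma> \<omega>} = {}" by blast
  then show ?thesis by (simp only: sets.empty_sets)
qed

text \<open>Whether \<open>\<sigma>\<close> is still running is decided by the first
  \<open>t\<close> samples, hence independent of the next one, and by \<open>v_Suc\<close> the mean
  of the better option equals the current value \<open>v (n - t)\<close>.\<close>

lemma integrable_max_gain:
  assumes "policy M X n \<sigma>" "t < n"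
  shows "integrable M (max_gain \<sigma> t)" and "(\<integral>\<omega>. max_gain \<sigma> t \<omega> \<partial>M) = 0"
proof -
  let ?A = "{\<omega> \<in> space M. t < \<sigma> \<omega>}" and ?f = "\<lambda>x. max x (v (n - Suc t)) - v (n - t)"
  have int: "integrable M (\<lambda>\<omega>. ?f (X (Suc t) \<omega>))"
    using integrable_X[of "Suc t"] \<open>t < n\<close> by auto
  have eq: "max_gain \<sigma> t \<omega> = indicator ?A \<omega> * ?f (X (Suc t) \<omega>)" if "\<omega> \<in> space M" for \<omega>
    using that by (simp add: max_gain_def)
  show "integrable M (max_gain \<sigma> t)"
    by (subst Bochner_Integration.integrable_cong[OF refl eq], assumption)
      (rule integrable_mult_indicator[OF policy_event_sets[OF assms(1)] int, unfolded real_scaleR_def])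
  have "(\<integral>\<omega>. max_gain \<sigma> t \<omega> \<partial>M) = (\<integral>\<omega>. indicator ?A \<omega> * ?f (X (Suc t) \<omega>) \<partial>M)"
    by (rule Bochner_Integration.integral_cong[OF refl eq])
  also have "\<dots> = prob ?A * (\<integral>\<omega>. ?f (X (Suc t) \<omega>) \<partial>M)"
    by (rule integral_indicator_natural_filtration[OF indep \<open>t < n\<close> policy_event[OF assms(1)] _ int]) auto
  also have "(\<integral>\<omega>. ?f (X (Suc t) \<omega>) \<partial>M) = 0"
    using v_Suc[of "Suc t" "n - Suc t"] \<open>t < n\<close> integrable_X[of "Suc t"]
    by (subst Bochner_Integration.integral_diff) (auto simp: prob_space Suc_diff_Suc)
  finally show "(\<integral>\<omega>. max_gain \<sigma> t \<omega> \<partial>M) = 0" by simp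
qed

lemma gain_le_max_gain: "gain \<sigma> t \<omega> \<le> max_gain \<sigma> t \<omega>"
  by (auto simp: gain_def max_gain_def)

lemma integrable_gain:
  assumes "policy M X n \<sigma>" "t < n"
  shows "integrable M (gain \<sigma> t)"
proof -
  define A where "A s = {\<omega> \<in> space M. s < \<sigma> \<omega>}" for s
  have A: "A s \<in> events" for s
    unfolding A_def by (rule policy_event_sets[OF assms(1)])
  \<comment> \<open>Split according to whether \<open>\<sigma>\<close> stops exactly at
    \<open>t + 1\<close> or runs on.\<close>
  have eq: "gain \<sigma> t \<omega> = indicator (A t - A (Suc t)) \<omega> *\<^sub>R (X (Suc t) \<omega> - v (n - t))
      + indicator (A (Suc t)) \<omega> *\<^sub>R (v (n - Suc t) - v (n - t))" if "\<omega> \<in> space M" for \<omega>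
    using that by (cases "t < \<sigma> \<omega>"; cases "\<sigma> \<omega> = Suc t") (simp_all add: gain_def A_def)
  have "integrable M (\<lambda>\<omega>. indicator (A t - A (Suc t)) \<omega> *\<^sub>R (X (Suc t) \<omega> - v (n - t)))"
    using A integrable_X[of "Suc t"] \<open>t < n\<close> by (intro integrable_mult_indicator) auto
  moreover have "integrable M (\<lambda>\<omega>. indicator (A (Suc t)) \<omega> *\<^sub>R (v (n - Suc t) - v (n - t)))"
    by (intro integrable_mult_indicator A) simp
  ultimately show ?thesis
    by (subst Bochner_Integration.integrable_cong[OF refl eq]) (auto intro: Bochner_Integration.integrable_add)
qed

lemma reward_eq_gains:
  assumes "policy M X n \<sigma>" "\<omega> \<in> space M"
  shows "(if \<sigma> \<omega> = n + 1 then 0 else X (\<sigma> \<omega>) \<omega>) = v n + (\<Sum>t<n. gain \<sigma> t \<omega>)"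
proof -
  have "\<sigma> \<omega> \<in> {1..n+1}" using assms by (auto simp: policy_def)
  then show ?thesis
    using reward_telescope[of "\<sigma> \<omega>" n n "\<lambda>t. X t \<omega>" v] by (auto simp: gain_def v_0)
qed

lemma expected_reward_eq_gains:
  assumes "policy M X n \<sigma>"
  shows "expected_reward M X n \<sigma> = v n + (\<Sum>t<n. (\<integral>\<omega>. gain \<sigma> t \<omega> \<partial>M))"
proof -
  have "expected_reward M X n \<sigma> = (\<integral>\<omega>. v n + (\<Sum>t<n. gain \<sigma> t \<omega>) \<partial>M)"
    unfolding expected_reward_def
    by (intro Bochner_Integration.integral_cong refl reward_eq_gains[OF assms])
  also have "\<dots> = v n + (\<Sum>t<n. (\<integral>\<omega>. gain \<sigma> t \<omega> \<partial>M))"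
    using integrable_gain[OF assms]
    by (subst Bochner_Integration.integral_add)
      (auto intro!: Bochner_Integration.integral_sum simp: prob_space)
  finally show ?thesis .
qed

text \<open>Every gain is dominated by a \<open>max_gain\<close>, whose mean is 0.\<close>

lemma expected_reward_le:
  assumes "policy M X n \<sigma>"
  shows "expected_reward M X n \<sigma> \<le> v n"
proof -
  have "(\<integral>\<omega>. gain \<sigma> t \<omega> \<partial>M) \<le> 0" if "t < n" for t
    using integral_mono[OF integrable_gain[OF assms that] integrable_max_gain(1)[OF assms that]]
      integrable_max_gain(2)[OF assms that] gain_le_max_gain by simp
  then show ?thesis
    unfolding expected_reward_eq_gains[OF assms] by (auto intro: sum_nonpos)
qed

text \<open>Accept the first sample that is at least the continuation value. The guard
  \<open>t \<le> n\<close> makes \<open>n + 1\<close> always admissible, so the least element exists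
  and is at most \<open>n + 1\<close>.\<close>

definition threshold_rule :: "'a \<Rightarrow> nat" where
  "threshold_rule \<omega> = (LEAST t. 1 \<le> t \<and> (t \<le> n \<longrightarrow> v (n - t) \<le> X t \<omega>))"

lemma threshold_rule_le_iff:
  "threshold_rule \<omega> \<le> t \<longleftrightarrow> (\<exists>s\<in>{1..t}. s \<le> n \<longrightarrow> v (n - s) \<le> X s \<omega>)"
  (is "_ \<longleftrightarrow> ?R")
proof
  let ?P = "\<lambda>t. 1 \<le> t \<and> (t \<le> n \<longrightarrow> v (n - t) \<le> X t \<omega>)"
  have "?P (n + 1)" by simp
  then have "?P (threshold_rule \<omega>)" unfolding threshold_rule_def by (rule LeastI)
  then show "threshold_rule \<omega> \<le> t \<Longrightarrow> ?R" by auto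
  assume ?R
  then obtain s where "s \<le> t" "?P s" by auto
  then show "threshold_rule \<omega> \<le> t"
    unfolding threshold_rule_def using Least_le[of ?P s] by linarith
qed

lemma policy_threshold_rule: "policy M X n threshold_rule"
  unfolding policy_def
proof (intro conjI ballI stopping_timeI)
  fix \<omega>
  show "threshold_rule \<omega> \<in> {1..n + 1}"
    using threshold_rule_le_iff[of \<omega> 0] threshold_rule_le_iff[of \<omega> "n + 1"]
    by (auto intro!: bexI[of _ "Suc n"] simp: not_le Suc_le_eq)
next
  fix t
  show "Measurable.pred (natural_filtration M X t) (\<lambda>\<omega>. threshold_rule \<omega> \<le> t)"
    unfolding threshold_rule_le_iff
  proof (intro pred_intros_finite pred_intros_logic)
    fix s assume "s \<in> {1..t}"
    then have [measurable]: "X s \<in> borel_measurable (natural_filtration M X t)"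
      by (auto intro: measurable_natural_filtration)
    show "Measurable.pred (natural_filtration M X t) (\<lambda>\<omega>. v (n - s) \<le> X s \<omega>)" by measurable
  qed auto
qed

text \<open>A rule still running after \<open>t\<close> stops at \<open>t + 1\<close> exactly if the
  sample is at least the continuation value, so its choice attains the maximum.\<close>

lemma gain_threshold_rule:
  assumes "t < n"
  shows "gain threshold_rule t \<omega> = max_gain threshold_rule t \<omega>"
proof (cases "threshold_rule \<omega> \<le> t")
  case False
  then have "threshold_rule \<omega> \<le> Suc t \<longleftrightarrow> v (n - Suc t) \<le> X (Suc t) \<omega>"
    using assms unfolding threshold_rule_le_iff by (auto simp: atLeastAtMostSuc_conv)
  then show ?thesis using False by (auto simp: gain_def max_gain_def)
qed (simp add: gain_def max_gain_def)

text \<open>The bound \<open>v n\<close> holds for all policies and is attained by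
  \<open>threshold_rule\<close>, which no optimal policy can fall below.\<close>

lemma expected_reward_optimal:
  assumes "optimal_policy M X n \<tau>"
  shows "expected_reward M X n \<tau> = v n"
proof (rule antisym)
  show "expected_reward M X n \<tau> \<le> v n"
    using assms by (intro expected_reward_le) (simp add: optimal_policy_def)
  have "v n = expected_reward M X n threshold_rule"
    unfolding expected_reward_eq_gains[OF policy_threshold_rule]
    using integrable_max_gain(2)[OF policy_threshold_rule]
    by (simp add: gain_threshold_rule cong: Bochner_Integration.integral_cong)
  also have "\<dots> \<le> expected_reward M X n \<tau>"
    using assms policy_threshold_rule by (auto simp: optimal_policy_def)
  finally show "v n \<le> expected_reward M X n \<tau>" .
qed

end


section \<open>The law of a sample and of its maximum\<close>

context exp_quantile
begin

text \<open>The tail of the minimum of \<open>n\<close> uniforms, by the antiderivative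
  \<open>- ((1 - u) ^ n)\<close>; the endpoints 0 and 1 form a null set.\<close>

lemma nn_integral_min_density:
  assumes "1 \<le> n" "0 \<le> a" "a \<le> 1"
  shows "(\<integral>\<^sup>+u. ennreal (min_density n u) * indicator {a..} u \<partial>lborel) = ennreal ((1 - a) ^ n)"
proof -
  have "(\<integral>\<^sup>+u. ennreal (min_density n u) * indicator {a..} u \<partial>lborel)
      = (\<integral>\<^sup>+u. ennreal (real n * (1 - u) ^ (n - 1)) * indicator {a..1} u \<partial>lborel)"
  proof (rule nn_integral_cong_AE)
    have "AE u in lborel. u \<noteq> (0::real) \<and> u \<noteq> 1"
      by (intro AE_conjI AE_lborel_singleton)
    then show "AE u in lborel. ennreal (min_density n u) * indicator {a..} u
        = ennreal (real n * (1 - u) ^ (n - 1)) * indicator {a..1} u"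
      by eventually_elim (use assms in \<open>auto simp: min_density_def split: split_indicator\<close>)
  qed
  also have "\<dots> = ennreal (- ((1 - 1) ^ n) - - ((1 - a) ^ n))"
  proof (rule nn_integral_FTC_Icc)
    show "((\<lambda>u. - ((1 - u) ^ n)) has_real_derivative real n * (1 - u) ^ (n - 1)) (at u)"
      for u :: real
      by (auto intro!: derivative_eq_intros)
  qed (use assms in auto)
  finally show ?thesis using assms by simp
qed

definition min_measure :: "nat \<Rightarrow> real measure" where
  "min_measure n = density lborel (\<lambda>u. ennreal (min_density n u))"

lemma measurable_min_density [measurable]: "min_density n \<in> borel_measurable borel"
  unfolding min_density_def by measurable

lemma min_density_nonneg: "0 \<le> min_density n u"
  by (auto simp: min_density_def split: split_indicator)

lemma sets_min_measure [simp, measurable_cong]: "sets (min_measure n) = sets borel"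
  by (simp add: min_measure_def)

lemma space_min_measure [simp]: "space (min_measure n) = UNIV"
  by (simp add: min_measure_def)

lemma emeasure_min_measure:
  "A \<in> sets borel \<Longrightarrow> emeasure (min_measure n) A = (\<integral>\<^sup>+u. ennreal (min_density n u) * indicator A u \<partial>lborel)"
  by (simp add: min_measure_def emeasure_density)

lemma prob_space_min_measure:
  assumes "1 \<le> n"
  shows "prob_space (min_measure n)"
proof
  have "emeasure (min_measure n) UNIV = (\<integral>\<^sup>+u. ennreal (min_density n u) * indicator {0..} u \<partial>lborel)"
    by (subst emeasure_min_measure)
      (auto intro!: nn_integral_cong simp: min_density_def split: split_indicator)
  then show "emeasure (min_measure n) (space (min_measure n)) = 1"
    using nn_integral_min_density[OF assms, of 0] by simp
qed

text \<open>By \<open>quantile_le_iff\<close> the event is a tail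
  \<open>exp (- \<theta> * \<phi> x) \<le> u\<close>, whose mass under the minimum is the
  \<open>n\<close>-th power of the distribution function.\<close>

lemma cdf_quantile:
  assumes "1 \<le> n"
  shows "cdf (distr (min_measure n) borel quantile) = (\<lambda>x. exp_cdf \<theta> x0 \<infinity> \<phi> x ^ n)"
proof
  fix x
  have quantile: "quantile \<in> measurable (min_measure n) borel" by measurable
  have "cdf (distr (min_measure n) borel quantile) x = measure (min_measure n) {u. quantile u \<le> x}"
    unfolding cdf_def by (subst measure_distr[OF quantile]) (auto intro!: arg_cong[where f = "measure _"])
  also have "emeasure (min_measure n) {u. quantile u \<le> x} = ennreal (exp_cdf \<theta> x0 \<infinity> \<phi> x ^ n)"
  proof (cases "x < x0")
    case True
    then have "{u. quantile u \<le> x} = {}" using quantile_ge by (auto simp: not_le intro: less_le_trans)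
    then show ?thesis using True assms by (simp add: exp_cdf_def)
  next
    case False
    define a where "a = exp (- \<theta> * \<phi> x)"
    have a: "0 \<le> a" "a \<le> 1" using False theta_pos phi_nonneg[of x] by (auto simp: a_def)
    have "emeasure (min_measure n) {u. quantile u \<le> x}
        = (\<integral>\<^sup>+u. ennreal (min_density n u) * indicator {a..} u \<partial>lborel)"
      using quantile_le_iff False
      by (subst emeasure_min_measure)
        (auto intro!: nn_integral_cong simp: min_density_def a_def split: split_indicator)
    then show ?thesis
      using nn_integral_min_density[OF assms a] False by (simp add: exp_cdf_def a_def)
  qed
  then have "measure (min_measure n) {u. quantile u \<le> x} = exp_cdf \<theta> x0 \<infinity> \<phi> x ^ n"
    using theta_pos phi_nonneg[of x] by (intro measure_eq_emeasure_eq_ennreal) (auto simp: exp_cdf_def)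
  finally show "cdf (distr (min_measure n) borel quantile) x = exp_cdf \<theta> x0 \<infinity> \<phi> x ^ n" .
qed

text \<open>Covers single samples, with exponent 1, and the maximum of \<open>n\<close> samples,
  with exponent \<open>n\<close>, by the same transfer to the unit interval.\<close>

context
  fixes M :: "'a measure" and Z :: "'a \<Rightarrow> real" and n :: nat
  assumes M: "prob_space M" and Z [measurable]: "Z \<in> borel_measurable M" and n: "1 \<le> n"
    and cdf_Z: "cdf (distr M borel Z) = (\<lambda>x. exp_cdf \<theta> x0 \<infinity> \<phi> x ^ n)"
begin

lemma distr_eq_quantile: "distr M borel Z = distr (min_measure n) borel quantile"
proof (rule cdf_unique)
  show "real_distribution (distr M borel Z)"
    using prob_space.real_distribution_distr[OF M Z] .
  show "real_distribution (distr (min_measure n) borel quantile)"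
    by (rule prob_space.real_distribution_distr[OF prob_space_min_measure[OF n]]) measurable
  show "cdf (distr M borel Z) = cdf (distr (min_measure n) borel quantile)"
    using cdf_Z cdf_quantile[OF n] by simp
qed

lemma integral_via_quantile:
  fixes h :: "real \<Rightarrow> real"
  assumes [measurable]: "h \<in> borel_measurable borel"
  shows "(\<integral>\<omega>. h (Z \<omega>) \<partial>M) = (\<integral>u. min_density n u * h (quantile u) \<partial>lborel)"
proof -
  have "(\<integral>\<omega>. h (Z \<omega>) \<partial>M) = (\<integral>x. h x \<partial>distr M borel Z)"
    by (rule integral_distr[symmetric]) measurable
  also have "\<dots> = (\<integral>u. h (quantile u) \<partial>min_measure n)"
    unfolding distr_eq_quantile by (rule integral_distr) measurable
  also have "\<dots> = (\<integral>u. min_density n u * h (quantile u) \<partial>lborel)"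
    unfolding min_measure_def by (subst integral_real_density) (auto simp: min_density_nonneg)
  finally show ?thesis .
qed

lemma integrable_via_quantile:
  fixes h :: "real \<Rightarrow> real"
  assumes [measurable]: "h \<in> borel_measurable borel"
  shows "integrable M (\<lambda>\<omega>. h (Z \<omega>)) \<longleftrightarrow> integrable lborel (\<lambda>u. min_density n u * h (quantile u))"
proof -
  have "integrable M (\<lambda>\<omega>. h (Z \<omega>)) \<longleftrightarrow> integrable (distr M borel Z) h"
    by (rule integrable_distr_eq[symmetric]) measurable
  also have "\<dots> \<longleftrightarrow> integrable (min_measure n) (\<lambda>u. h (quantile u))"
    unfolding distr_eq_quantile by (rule integrable_distr_eq) measurable
  also have "\<dots> \<longleftrightarrow> integrable lborel (\<lambda>u. min_density n u * h (quantile u))"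
    unfolding min_measure_def by (subst integrable_real_density) (auto simp: min_density_nonneg)
  finally show ?thesis .
qed

end

section \<open>Samples and maxima as quantile integrals\<close>

lemma min_density_1: "min_density 1 u = indicator {0<..<1} u"
  by (simp add: min_density_def)

text \<open>Single samples are the case of exponent 1, where the density is the indicator of the
  unit interval; the Bellman equation \<open>v_Suc\<close> then becomes
  \<open>stop_value_Suc\<close>.\<close>

lemma optimal_stopping_iid:
  assumes "iid_sample M X n (exp_cdf \<theta> x0 \<infinity> \<phi>)"
  shows "optimal_stopping M X n stop_value"
proof -
  have M: "prob_space M" and indep: "prob_space.indep_vars M (\<lambda>_. borel) X {1..n}"
    and cdf: "\<And>t. t \<in> {1..n} \<Longrightarrow> cdf (distr M borel (X t)) = (\<lambda>x. exp_cdf \<theta> x0 \<infinity> \<phi> x ^ 1)"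
    using assms by (auto simp: iid_sample_def)
  interpret prob_space M by fact
  have meas: "X t \<in> borel_measurable M" if "t \<in> {1..n}" for t
    using indep that by (auto simp: indep_vars_def2)
  show ?thesis
  proof (unfold_locales; (rule indep stop_value.simps)?)
    fix t assume t: "t \<in> {1..n}"
    show "integrable M (X t)"
      using integrable_via_quantile[OF M meas[OF t] order_refl cdf[OF t], of "\<lambda>x. x"]
        integrable_quantile
      by (simp only: min_density_1) simp
    show "(\<integral>\<omega>. max (X t \<omega>) (stop_value k) \<partial>M) = stop_value (Suc k)" for k
      using integral_via_quantile[OF M meas[OF t] order_refl cdf[OF t], of "\<lambda>x. max x (stop_value k)"]
      unfolding stop_value_Suc by (simp only: min_density_1) simp
  qed
qed

text \<open>The maximum is at most \<open>x\<close> iff all samples are, so by independence its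
  distribution function is the \<open>n\<close>-th power of the common one.\<close>

lemma OPT_iid:
  assumes "iid_sample M X n (exp_cdf \<theta> x0 \<infinity> \<phi>)" and n: "1 \<le> n"
  shows "OPT M X n = (\<integral>u. min_density n u * quantile u \<partial>lborel)"
proof -
  have M: "prob_space M" and indep: "prob_space.indep_vars M (\<lambda>_. borel) X {1..n}"
    and cdf: "\<And>t. t \<in> {1..n} \<Longrightarrow> cdf (distr M borel (X t)) = exp_cdf \<theta> x0 \<infinity> \<phi>"
    using assms by (auto simp: iid_sample_def)
  interpret prob_space M by fact
  have meas [measurable]: "X t \<in> borel_measurable M" if "t \<in> {1..n}" for t
    using indep that by (auto simp: indep_vars_def2)
  have Max_meas: "(\<lambda>\<omega>. MAX t\<in>{1..n}. X t \<omega>) \<in> borel_measurable M"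
    by (intro borel_measurable_Max) (auto simp: meas)
  have "cdf (distr M borel (\<lambda>\<omega>. MAX t\<in>{1..n}. X t \<omega>)) = (\<lambda>x. exp_cdf \<theta> x0 \<infinity> \<phi> x ^ n)"
  proof
    fix x
    have "cdf (distr M borel (\<lambda>\<omega>. MAX t\<in>{1..n}. X t \<omega>)) x
        = prob ((\<lambda>\<omega>. MAX t\<in>{1..n}. X t \<omega>) -` {..x} \<inter> space M)"
      unfolding cdf_def by (rule measure_distr[OF Max_meas]) simp
    also have "(\<lambda>\<omega>. MAX t\<in>{1..n}. X t \<omega>) -` {..x} \<inter> space M = (\<Inter>t\<in>{1..n}. X t -` {..x} \<inter> space M)"
      using n by auto
    also have "prob \<dots> = (\<Prod>t\<in>{1..n}. prob (X t -` {..x} \<inter> space M))"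
      using n by (intro indep_varsD_finite[OF indep]) auto
    also have "\<dots> = (\<Prod>t\<in>{1..n}. exp_cdf \<theta> x0 \<infinity> \<phi> x)"
    proof (rule prod.cong[OF refl])
      fix t assume t: "t \<in> {1..n}"
      show "prob (X t -` {..x} \<inter> space M) = exp_cdf \<theta> x0 \<infinity> \<phi> x"
        using measure_distr[OF meas[OF t], of "{..x}"] fun_cong[OF cdf[OF t], of x] by (simp add: cdf_def)
    qed
    finally show "cdf (distr M borel (\<lambda>\<omega>. MAX t\<in>{1..n}. X t \<omega>)) x = exp_cdf \<theta> x0 \<infinity> \<phi> x ^ n"
      by simp
  qed
  from integral_via_quantile[OF M Max_meas n this, of "\<lambda>x. x"]
  show ?thesis by (simp add: OPT_def)
qed

end


section \<open>The asymptotics\<close>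

text \<open>Mean value inequality for \<open>ln \<psi> y - c * y\<close>, whose derivative
  \<open>\<psi>' / \<psi> - c\<close> is bounded by \<open>\<epsilon>\<close> beyond
  \<open>Y\<close>.\<close>

lemma log_increment_of_log_deriv:
  fixes \<psi> :: "real \<Rightarrow> real"
  assumes pos: "\<And>y. 0 < y \<Longrightarrow> 0 < \<psi> y"
    and diff: "\<forall>\<^sub>F y in at_top. \<psi> differentiable (at y)"
    and lim: "((\<lambda>y. deriv \<psi> y / \<psi> y) \<longlongrightarrow> c) at_top" and "0 < \<epsilon>"
  shows "\<exists>Y>0. \<forall>y\<ge>Y. \<forall>z\<ge>Y. \<bar>ln (\<psi> z) - ln (\<psi> y) - c * (z - y)\<bar> \<le> \<epsilon> * \<bar>z - y\<bar>"
proof -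
  have "\<forall>\<^sub>F y in at_top. \<psi> differentiable (at y) \<and> dist (deriv \<psi> y / \<psi> y) c < \<epsilon> \<and> 0 < y"
    using diff tendstoD[OF lim \<open>0 < \<epsilon>\<close>] eventually_gt_at_top[of 0] by eventually_elim simp
  then obtain Y where Y: "\<And>y. y \<ge> Y \<Longrightarrow> \<psi> differentiable (at y) \<and> dist (deriv \<psi> y / \<psi> y) c < \<epsilon> \<and> 0 < y"
    by (auto simp: eventually_at_top_linorder)
  define g where "g y = ln (\<psi> y) - c * y" for y
  have g: "(g has_field_derivative (deriv \<psi> y / \<psi> y - c)) (at y within {Y..})" if "y \<in> {Y..}" for y
  proof -
    have "\<psi> differentiable (at y)" and "0 < \<psi> y" using Y[of y] that pos by auto
    then have "(\<psi> has_field_derivative deriv \<psi> y) (at y)"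
      by (simp add: DERIV_deriv_iff_real_differentiable)
    then have "(g has_field_derivative (deriv \<psi> y / \<psi> y - c)) (at y)"
      unfolding g_def using \<open>0 < \<psi> y\<close> by (auto intro!: derivative_eq_intros simp: field_simps)
    then show ?thesis by (rule has_field_derivative_at_within)
  qed
  have "\<bar>ln (\<psi> z) - ln (\<psi> y) - c * (z - y)\<bar> \<le> \<epsilon> * \<bar>z - y\<bar>" if "y \<ge> Y" "z \<ge> Y" for y z
  proof -
    have "norm (g z - g y) \<le> \<epsilon> * norm (z - y)"
    proof (rule field_differentiable_bound[OF _ g])
      show "norm (deriv \<psi> x / \<psi> x - c) \<le> \<epsilon>" if "x \<in> {Y..}" for x
        using Y[of x] that by (auto simp: dist_real_def)
    qed (use that in auto)
    then show ?thesis by (simp add: g_def algebra_simps)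
  qed
  then show ?thesis using Y[of Y] by blast
qed

lemma exp_quantile_of_regular:
  assumes family: "exp_type_family \<theta> x0 xF \<phi>" and regular: "unbounded_endpoint_regular \<theta> x0 xF \<phi> c c'"
  shows "exp_quantile \<theta> c x0 \<phi> (exp_inverse x0 xF \<phi>)"
proof -
  define \<psi> where "\<psi> = exp_inverse x0 xF \<phi>"
  have xF: "xF = \<infinity>" and c: "0 \<le> c" "c < \<theta>"
    and diff: "\<forall>\<^sub>F y in at_top. \<psi> differentiable (at y)"
    and lim: "((\<lambda>y. deriv \<psi> y / \<psi> y) \<longlongrightarrow> c) at_top"
    using regular
    by (auto simp: unbounded_endpoint_regular_def Let_def \<psi>_def elim: eventually_mono)
  have supp: "exp_support x0 xF = {x0..}" by (auto simp: exp_support_def xF)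
  have theta: "0 < \<theta>" and x0: "0 \<le> x0" and mono: "strict_mono_on {x0..} \<phi>"
    and bij: "bij_betw \<phi> {x0..} {0..}" and phi_x0: "\<phi> x0 = 0"
    using family by (auto simp: exp_type_family_def supp)
  have \<psi>_inv: "\<psi> = inv_into {x0..} \<phi>" by (simp add: \<psi>_def exp_inverse_def supp)
  have psi_ge: "x0 \<le> \<psi> y" and phi_psi: "\<phi> (\<psi> y) = y" if "0 \<le> y" for y
    using that bij_betw_inv_into_right[OF bij, of y] bij_betw_apply[OF bij_betw_inv_into[OF bij], of y]
    by (auto simp: \<psi>_inv)
  have psi_pos: "0 < \<psi> y" if "0 < y" for y
  proof -
    \<comment> \<open>Since \<open>\<phi> x0 = 0\<close>, the value \<open>x0\<close> is taken by
      \<open>\<psi>\<close> at 0 only; hence \<open>\<psi> y > x0 \<ge> 0\<close>.\<close>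
    have "\<psi> y \<noteq> x0" using phi_psi[of y] phi_x0 that by auto
    then show ?thesis using psi_ge[of y] x0 that by simp
  qed
  show ?thesis unfolding \<psi>_def[symmetric]
  proof
    show "0 \<le> \<phi> x" if "x0 \<le> x" for x
      using bij_betw_apply[OF bij, of x] that by simp
    show "\<psi> (\<phi> x) = x" if "x0 \<le> x" for x
      using bij_betw_inv_into_left[OF bij, of x] that by (simp add: \<psi>_inv)
    show "\<phi> x \<le> \<phi> y \<longleftrightarrow> x \<le> y" if "x0 \<le> x" "x0 \<le> y" for x y
      using strict_mono_on_leD[OF mono, of x y] strict_mono_onD[OF mono, of y x] that
      by (auto simp: not_le[symmetric])
    show "\<exists>Y>0. \<forall>y\<ge>Y. \<forall>z\<ge>Y. \<bar>ln (\<psi> z) - ln (\<psi> y) - c * (z - y)\<bar> \<le> \<epsilon> * \<bar>z - y\<bar>" if "0 < \<epsilon>" for \<epsilon>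
      by (rule log_increment_of_log_deriv[OF psi_pos diff lim that])
  qed (use theta x0 c psi_ge phi_psi in auto)
qed

theorem theorem6:
  fixes \<theta> x0 c c' :: real and xF :: ereal and \<phi> :: "real \<Rightarrow> real"
    and M :: "nat \<Rightarrow> 'a measure" and X :: "nat \<Rightarrow> nat \<Rightarrow> 'a \<Rightarrow> real" and \<tau> :: "nat \<Rightarrow> 'a \<Rightarrow> nat"
  assumes family: "exp_type_family \<theta> x0 xF \<phi>"
    and regular: "unbounded_endpoint_regular \<theta> x0 xF \<phi> c c'"
    and iid: "\<And>n. n \<ge> 1 \<Longrightarrow> iid_sample (M n) (X n) n (exp_cdf \<theta> x0 xF \<phi>)"
    and optimal: "\<And>n. n \<ge> 1 \<Longrightarrow> optimal_policy (M n) (X n) n (\<tau> n)"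
  shows "((\<lambda>n. expected_reward (M n) (X n) n (\<tau> n))
            \<sim>[at_top] (\<lambda>n. (\<theta> / (\<theta> - c)) powr (c / \<theta>) * exp_inverse x0 xF \<phi> (ln (real n) / \<theta>)))
       \<and> ((\<lambda>n. OPT (M n) (X n) n)
            \<sim>[at_top] (\<lambda>n. Gamma (1 - c / \<theta>) * exp_inverse x0 xF \<phi> (ln (real n) / \<theta>)))
       \<and> ((\<lambda>n. CR (M n) (X n) n (\<tau> n))
            \<longlonglongrightarrow> (\<theta> / (\<theta> - c)) powr (c / \<theta>) / Gamma (1 - c / \<theta>))"
proof -
  define \<psi> where "\<psi> = exp_inverse x0 xF \<phi>"
  interpret exp_quantile \<theta> c x0 \<phi> \<psi>
    unfolding \<psi>_def by (rule exp_quantile_of_regular[OF family regular])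
  have xF: "xF = \<infinity>" using regular by (simp add: unbounded_endpoint_regular_def Let_def)
  define A where "A = (\<theta> / (\<theta> - c)) powr (c / \<theta>)"
  define B where "B = Gamma (1 - c / \<theta>)"
  define b where "b n = \<psi> (ln (real n) / \<theta>)" for n
  define E where "E n = expected_reward (M n) (X n) n (\<tau> n)" for n
  define Opt where "Opt n = OPT (M n) (X n) n" for n
  have "A > 0" using theta_pos c_less by (simp add: A_def)
  have "B > 0" using theta_pos c_less by (simp add: B_def Gamma_real_pos)
  have E: "\<forall>\<^sub>F n in sequentially. stop_value n / b n = E n / b n"
    using eventually_ge_at_top[of 1]
  proof eventually_elim
    case (elim n)
    then show ?case
      using optimal_stopping.expected_reward_optimal[OF optimal_stopping_iid optimal] iid
      by (simp add: E_def xF)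
  qed
  have E_lim: "(\<lambda>n. E n / b n) \<longlonglongrightarrow> A"
    unfolding A_def using stop_value_asymp E by (auto simp: b_def[symmetric] intro: Lim_transform_eventually)
  have O_ev: "\<forall>\<^sub>F n in sequentially. (\<integral>u. min_density n u * quantile u \<partial>lborel) / b n = Opt n / b n"
    using eventually_ge_at_top[of 1]
    by eventually_elim (simp add: Opt_def xF OPT_iid[OF iid[unfolded xF]])
  have O_lim: "(\<lambda>n. Opt n / b n) \<longlonglongrightarrow> B"
    unfolding B_def using integral_max_asymp O_ev by (auto simp: b_def[symmetric] intro: Lim_transform_eventually)
  have "E \<sim>[at_top] (\<lambda>n. A * b n)"
    using tendsto_divide[OF E_lim tendsto_const[of A]] \<open>A > 0\<close>
    by (intro asymp_equivI') (simp add: field_simps)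
  moreover have "Opt \<sim>[at_top] (\<lambda>n. B * b n)"
    using tendsto_divide[OF O_lim tendsto_const[of B]] \<open>B > 0\<close>
    by (intro asymp_equivI') (simp add: field_simps)
  moreover have "(\<lambda>n. E n / Opt n) \<longlonglongrightarrow> A / B"
  proof (rule Lim_transform_eventually)
    show "(\<lambda>n. (E n / b n) / (Opt n / b n)) \<longlonglongrightarrow> A / B"
      using \<open>B > 0\<close> by (intro tendsto_divide E_lim O_lim) simp
    \<comment> \<open>The common normaliser cancels only where it is nonzero;
      \<open>\<psi> 0 = x0\<close> may be 0, so the argument has to be positive.\<close>
    have "\<forall>\<^sub>F n in sequentially. 0 < ln (real n) / \<theta>"
      using ln_over_theta_at_top by (simp add: filterlim_at_top_dense)
    then show "\<forall>\<^sub>F n in sequentially. (E n / b n) / (Opt n / b n) = E n / Opt n"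
      by eventually_elim (use psi_pos in \<open>simp add: b_def less_imp_neq[symmetric]\<close>)
  qed
  ultimately show ?thesis
    by (simp add: A_def B_def b_def \<psi>_def E_def[abs_def] Opt_def[abs_def] CR_def)
qed

end
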